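(* Let $k\in\mathbb N$. The operators $M_{z_j}$, $j\in\mathbb N$, of multiplication by $z_j$ are bounded from $\mathcal H(K_k)$ into itself. A linear operator $T$ from $\mathbf H_2(\mathbb D)\otimes\mathcal H(K_k)$ into itself is contractive and such that $$T(M_\zeta f)=M_\zeta Tf,\qquad T(M_{z_j}f)=M_{z_j}Tf$$ for all $f\in\mathbf H_2(\mathbb D)\otimes\mathcal H(K_k)$ and all $j\in\mathbb N$, if and only if it is of the form $$(Tf)(\zeta,z)=\mathscr S(\zeta,z)f(\zeta,z),$$ where $\mathscr S$ is such that the kernel $$(1-\mathscr S(\zeta,z)\mathscr S(\nu,w)^* )\frac{K_k(z,w)}{1-\zeta\nu^*}$$ is positive in $\mathbb D\times\mathbb K_k$.
   Context: $\mathbb N=\{1,2,\ldots\}$; $\mathbb D$ is the open unit disk; $^*$ on complex numbers is complex conjugation; a kernel is positive if it is positive semidefinite. $\ell$ denotes the set of sequences $\alpha=(\alpha_1,\alpha_2,\ldots)$ of nonnegative integers indexed by $\mathbb N$ with $\alpha_j=0$ for all large $j$; $(2\mathbb N)^{k\alpha}=\prod_j(2j)^{k\alpha_j}$; $z^\alpha=z_1^{\alpha_1}z_2^{\alpha_2}\cdots$. Let $\mathbb K_k=\{z\in\mathbb C^{\mathbb N}:\sum_{\alpha\in\ell}|z|^{2\alpha}(2\mathbb N)^{k\alpha}<\infty\}$ and $K_k(z,w)=\sum_{\alpha\in\ell}z^\alpha(w^* )^\alpha(2\mathbb N)^{k\alpha}$ for $z,w\in\mathbb K_k$; $\mathcal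 H(K_k)$ is the reproducing kernel Hilbert space on $\mathbb K_k$ with kernel $K_k$ (functions $\sum_\alpha c_\alpha z^\alpha$ with squared norm $\sum_\alpha|c_\alpha|^2(2\mathbb N)^{-k\alpha}<\infty$). $\mathbf H_2(\mathbb D)$ is the Hardy space, and $\mathbf H_2(\mathbb D)\otimes\mathcal H(K_k)=\{f(\zeta)=\sum_{n\ge0}\zeta^nf_n:\ f_n\in\mathcal H(K_k)\}$ with $\|f\|^2=\sum_{n\ge0}\|f_n\|^2_{\mathcal H(K_k)}<\infty$, viewed as the reproducing kernel Hilbert space of functions $f(\zeta,z)$ on $\mathbb D\times\mathbb K_k$ with kernel $K_k(z,w)/(1-\zeta\nu^* )$. $M_\zeta$ and $M_{z_j}$ denote the operators of multiplication by $\zeta$ and by $z_j$; $\mathscr S$ is a complex-valued function on $\mathbb D\times\mathbb K_k$. *)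

theory Defs
  imports "HOL-Analysis.Analysis" "HOL-Library.Poly_Mapping"
begin

text \<open>
  Sequences indexed by \<open>{1, 2, \<dots>}\<close> are encoded with index type \<^typ>\<open>nat\<close> starting at 0:
  the index \<open>i\<close> stands for the \<open>(i + 1)\<close>-st entry. The set \<open>\<ell>\<close> of multi-indices is the
  type \<^typ>\<open>nat \<Rightarrow>\<^sub>0 nat\<close>.
\<close>

definition mpow :: "(nat \<Rightarrow> 'a::comm_monoid_mult) \<Rightarrow> (nat \<Rightarrow>\<^sub>0 nat) \<Rightarrow> 'a" where
  "mpow z \<alpha> = (\<Prod>i\<in>Poly_Mapping.keys \<alpha>. z i ^ Poly_Mapping.lookup \<alpha> i)"

text \<open>\<open>(2\<nat>)\<^sup>k\<^sup>\<alpha>\<close>; the factor \<open>2j\<close> is \<open>2 (i + 1)\<close> because of the index shift.\<close>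

definition wt :: "nat \<Rightarrow> (nat \<Rightarrow>\<^sub>0 nat) \<Rightarrow> real" where
  "wt k \<alpha> = mpow (\<lambda>i. (2 * real (Suc i)) ^ k) \<alpha>"

definition KK :: "nat \<Rightarrow> (nat \<Rightarrow> complex) set" where
  "KK k = {z. (\<lambda>\<alpha>. (mpow (\<lambda>i. cmod (z i)) \<alpha>)\<^sup>2 * wt k \<alpha>) summable_on UNIV}"

definition Kker :: "nat \<Rightarrow> (nat \<Rightarrow> complex) \<Rightarrow> (nat \<Rightarrow> complex) \<Rightarrow> complex" where
  "Kker k z w = (\<Sum>\<^sub>\<infinity>\<alpha>. mpow z \<alpha> * mpow (\<lambda>i. cnj (w i)) \<alpha> * of_real (wt k \<alpha>))"

definition positive_kernel :: "'a set \<Rightarrow> ('a \<Rightarrow> 'a \<Rightarrow> complex) \<Rightarrow> bool" where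
  "positive_kernel X K \<longleftrightarrow>
     (\<forall>n::nat. \<forall>x c. (\<forall>i<n. x i \<in> X) \<longrightarrow>
        (\<Sum>i<n. \<Sum>j<n. cnj (c i) * K (x i) (x j) * c j) \<in> \<real>\<^sub>\<ge>\<^sub>0)"


text \<open>
  A function on \<^term>\<open>KK k\<close> (below: on the product of the unit disc with \<^term>\<open>KK k\<close>) is
  represented by its extension by 0 to the whole type, so that equality of elements of the
  Hilbert spaces is equality in HOL. A square-summable coefficient family is determined by its
  function, so \<^const>\<open>the_inv_into\<close> recovers it in the definitions of the norms.
\<close>

definition H_coeffs :: "nat \<Rightarrow> ((nat \<Rightarrow>\<^sub>0 nat) \<Rightarrow> complex) set" where
  "H_coeffs k = {c. (\<lambda>\<alpha>. (cmod (c \<alpha>))\<^sup>2 / wt k \<alpha>) summable_on UNIV}"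

definition H_fun :: "nat \<Rightarrow> ((nat \<Rightarrow>\<^sub>0 nat) \<Rightarrow> complex) \<Rightarrow> (nat \<Rightarrow> complex) \<Rightarrow> complex" where
  "H_fun k c = (\<lambda>z. if z \<in> KK k then (\<Sum>\<^sub>\<infinity>\<alpha>. c \<alpha> * mpow z \<alpha>) else 0)"

definition HK :: "nat \<Rightarrow> ((nat \<Rightarrow> complex) \<Rightarrow> complex) set" where
  "HK k = H_fun k ` H_coeffs k"

definition H_norm :: "nat \<Rightarrow> ((nat \<Rightarrow> complex) \<Rightarrow> complex) \<Rightarrow> real" where
  "H_norm k f =
     sqrt (\<Sum>\<^sub>\<infinity>\<alpha>. (cmod (the_inv_into (H_coeffs k) (H_fun k) f \<alpha>))\<^sup>2 / wt k \<alpha>)"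


definition HH_coeffs :: "nat \<Rightarrow> (nat \<Rightarrow> (nat \<Rightarrow> complex) \<Rightarrow> complex) set" where
  "HH_coeffs k = {F. (\<forall>n. F n \<in> HK k) \<and> summable (\<lambda>n. (H_norm k (F n))\<^sup>2)}"

definition HH_fun ::
  "(nat \<Rightarrow> (nat \<Rightarrow> complex) \<Rightarrow> complex) \<Rightarrow> complex \<times> (nat \<Rightarrow> complex) \<Rightarrow> complex" where
  "HH_fun F = (\<lambda>(\<zeta>, z). if \<zeta> \<in> ball 0 1 then suminf (\<lambda>n. \<zeta> ^ n * F n z) else 0)"

text \<open>The tensor product of the Hardy space of the disc with \<^term>\<open>HK k\<close>.\<close>

definition HHK :: "nat \<Rightarrow> (complex \<times> (nat \<Rightarrow> complex) \<Rightarrow> complex) set" where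
  "HHK k = HH_fun ` HH_coeffs k"

definition HH_norm :: "nat \<Rightarrow> (complex \<times> (nat \<Rightarrow> complex) \<Rightarrow> complex) \<Rightarrow> real" where
  "HH_norm k f = sqrt (suminf (\<lambda>n. (H_norm k (the_inv_into (HH_coeffs k) HH_fun f n))\<^sup>2))"


definition mult_op :: "('a \<Rightarrow> complex) \<Rightarrow> ('a \<Rightarrow> complex) \<Rightarrow> 'a \<Rightarrow> complex" where
  "mult_op \<phi> f = (\<lambda>x. \<phi> x * f x)"

text \<open>Only the values of \<open>T\<close> on the function space \<open>V\<close> matter.\<close>

definition linear_operator_on ::
  "('a \<Rightarrow> complex) set \<Rightarrow> (('a \<Rightarrow> complex) \<Rightarrow> 'a \<Rightarrow> complex) \<Rightarrow> bool" where
  "linear_operator_on V T \<longleftrightarrow>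
     (\<forall>f\<in>V. T f \<in> V) \<and>
     (\<forall>f\<in>V. \<forall>g\<in>V. T (\<lambda>x. f x + g x) = (\<lambda>x. T f x + T g x)) \<and>
     (\<forall>a. \<forall>f\<in>V. T (\<lambda>x. a * f x) = (\<lambda>x. a * T f x))"

definition bounded_operator_on ::
  "('a \<Rightarrow> complex) set \<Rightarrow> (('a \<Rightarrow> complex) \<Rightarrow> real) \<Rightarrow> (('a \<Rightarrow> complex) \<Rightarrow> 'a \<Rightarrow> complex) \<Rightarrow> bool"
  where
  "bounded_operator_on V N T \<longleftrightarrow>
     linear_operator_on V T \<and> (\<exists>C. \<forall>f\<in>V. N (T f) \<le> C * N f)"

definition contractive_on ::
  "('a \<Rightarrow> complex) set \<Rightarrow> (('a \<Rightarrow> complex) \<Rightarrow> real) \<Rightarrow> (('a \<Rightarrow> complex) \<Rightarrow> 'a \<Rightarrow> complex) \<Rightarrow> bool"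
  where
  "contractive_on V N T \<longleftrightarrow> (\<forall>f\<in>V. N (T f) \<le> N f)"

end

theory Submission
  imports Defs
begin

text \<open>
  Both Hilbert spaces of the theorem are copies of \<open>\<ell>\<^sup>2\<close> over a set of indices: normalised
  monomials \<open>e\<^sub>i\<close> form an orthonormal basis, and \<open>(e\<^sub>i(x))\<^sub>i\<close> is square-summable at every point \<open>x\<close>
  of the domain. Then \<open>a \<mapsto> \<Sum>\<^sub>i a\<^sub>i e\<^sub>i\<close> turns \<open>\<ell>\<^sup>2\<close> into functions, evaluation at \<open>x\<close> is the inner product
  with the kernel vector \<open>(e\<^sub>i(x)\<^sup>*)\<^sub>i\<close>, and the reproducing kernel is \<open>\<Sum>\<^sub>i e\<^sub>i(x) e\<^sub>i(y)\<^sup>*\<close>. The general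
  argument is carried out in the locale \<open>feature_space\<close>.

  Multipliers and positivity: the adjoint of multiplication by \<open>S\<close> sends the kernel vector at \<open>x\<close> to
  \<open>S(x)\<^sup>*\<close> times itself. The quadratic form of the kernel \<open>(1 - S(x) S(y)\<^sup>*) K(x, y)\<close> is therefore
  \<open>\<parallel>u\<parallel>\<^sup>2 - \<parallel>M\<^sub>S\<^sup>* u\<parallel>\<^sup>2\<close> for a finite combination \<open>u\<close> of kernel vectors. It is nonnegative if \<open>M\<^sub>S\<close> is a
  contraction (\<open>positive_kernel_if_contractive_multiplier\<close>). Conversely, positivity bounds the functional
  that an element \<open>S f\<close> ought to induce on combinations of kernel vectors, and the Riesz representation
  theorem produces this element (\<open>contractive_multiplier_if_positive_kernel\<close>).

  Commuting operators: if \<open>T\<close> commutes with all the coordinate multiplications, then \<open>T p = (T 1) p\<close> for every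
  monomial \<open>p\<close>, hence for polynomials. Polynomials are dense, \<open>T\<close> is contractive and point evaluations are
  bounded, so \<open>T f = (T 1) f\<close> for all \<open>f\<close> (\<open>contraction_is_multiplier\<close>).

  It remains to see that the norms of the two function spaces are the \<open>\<ell>\<^sup>2\<close> norms, that is, that
  a function determines its coefficients, although it depends on infinitely many variables.
  Evaluate at \<open>z = (p\<^sub>1\<^sup>-\<^sup>s, p\<^sub>2\<^sup>-\<^sup>s, \<dots>)\<close> for distinct primes \<open>p\<^sub>i\<close>: a power series becomes a Dirichlet
  series in \<open>s\<close> with the same coefficients, and these are determined by the values for large \<open>s\<close>
  (\<open>Dirichlet_coefficients_unique\<close>).
\<close>

section \<open>Square-summable families\<close>

definition ell2 :: "('i \<Rightarrow> complex) set" where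
  "ell2 = {a. (\<lambda>i. (cmod (a i))\<^sup>2) summable_on UNIV}"

definition norm_sq :: "('i \<Rightarrow> complex) \<Rightarrow> real" where
  "norm_sq a = (\<Sum>\<^sub>\<infinity>i. (cmod (a i))\<^sup>2)"

definition ell2_inner :: "('i \<Rightarrow> complex) \<Rightarrow> ('i \<Rightarrow> complex) \<Rightarrow> complex" where
  "ell2_inner a b = (\<Sum>\<^sub>\<infinity>i. a i * cnj (b i))"

lemma norm_sq_nonneg: "norm_sq a \<ge> 0"
  unfolding norm_sq_def by (rule infsum_nonneg) simp

lemma ell2_0: "(\<lambda>_. 0) \<in> ell2" and norm_sq_0: "norm_sq (\<lambda>_. 0) = 0"
  by (simp_all add: ell2_def norm_sq_def)

lemma ell2_boundedI:
  assumes "\<And>F. finite F \<Longrightarrow> (\<Sum>i\<in>F. (cmod (a i))\<^sup>2) \<le> B"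
  shows "a \<in> ell2" and "norm_sq a \<le> B"
proof -
  show "a \<in> ell2"
    unfolding ell2_def mem_Collect_eq
    by (rule nonneg_bdd_above_summable_on) (auto intro!: bdd_aboveI2[where M = B] assms)
  then show "norm_sq a \<le> B"
    unfolding norm_sq_def ell2_def mem_Collect_eq by (rule infsum_le_finite_sums) (use assms in auto)
qed

lemma sum_le_norm_sq:
  assumes "a \<in> ell2" "finite F"
  shows "(\<Sum>i\<in>F. (cmod (a i))\<^sup>2) \<le> norm_sq a"
  unfolding norm_sq_def using assms by (intro finite_sum_le_infsum) (auto simp: ell2_def)

lemma entry_le_norm_sq:
  assumes "a \<in> ell2"
  shows "(cmod (a i))\<^sup>2 \<le> norm_sq a"
  using sum_le_norm_sq[OF assms, of "{i}"] by simp

lemma norm_sq_eq_0D: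
  assumes "a \<in> ell2" "norm_sq a = 0"
  shows "a = (\<lambda>_. 0)"
proof
  fix i
  show "a i = 0" using entry_le_norm_sq[OF assms(1), of i] assms(2) by simp
qed

lemma infsum_finite_support:
  assumes "finite F" "\<And>i. i \<notin> F \<Longrightarrow> f i = 0"
  shows "(\<Sum>\<^sub>\<infinity>i. f i) = (\<Sum>i\<in>F. f i)"
proof -
  have "(\<Sum>\<^sub>\<infinity>i. f i) = (\<Sum>\<^sub>\<infinity>i\<in>F. f i)"
    by (rule infsum_cong_neutral) (use assms in auto)
  then show ?thesis using assms by simp
qed

lemma finite_support_ell2:
  assumes "finite F" "\<And>i. i \<notin> F \<Longrightarrow> a i = 0"
  shows "a \<in> ell2"
proof -
  have "(\<lambda>i. (cmod (a i))\<^sup>2) summable_on F" using assms by simp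
  then have "(\<lambda>i. (cmod (a i))\<^sup>2) summable_on UNIV"
    by (subst summable_on_cong_neutral[where T = F and g = "\<lambda>i. (cmod (a i))\<^sup>2"]) (use assms in auto)
  then show ?thesis by (simp add: ell2_def)
qed

lemma ell2_mult_summable:
  assumes "a \<in> ell2" "b \<in> ell2"
  shows "(\<lambda>i. cmod (a i) * cmod (b i)) summable_on UNIV"
proof -
  have "(\<lambda>i. (cmod (a i))\<^sup>2 + (cmod (b i))\<^sup>2) summable_on UNIV"
    using assms by (intro summable_on_add) (auto simp: ell2_def)
  then show ?thesis
  proof (rule summable_on_comparison_test)
    fix i
    have "2 * (cmod (a i) * cmod (b i)) \<le> (cmod (a i))\<^sup>2 + (cmod (b i))\<^sup>2"
      using sum_squares_bound[of "cmod (a i)" "cmod (b i)"] by (simp add: mult.assoc)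
    moreover have "0 \<le> cmod (a i) * cmod (b i)" by simp
    ultimately show "cmod (a i) * cmod (b i) \<le> (cmod (a i))\<^sup>2 + (cmod (b i))\<^sup>2"
      by linarith
  qed auto
qed

lemma ell2_product_abs_summable:
  assumes "a \<in> ell2" "b \<in> ell2"
  shows "(\<lambda>i. norm (a i * b i)) summable_on UNIV"
  using ell2_mult_summable[OF assms] by (simp add: norm_mult)

lemma ell2_cnj: "a \<in> ell2 \<Longrightarrow> (\<lambda>i. cnj (a i)) \<in> ell2"
  by (simp add: ell2_def)

lemma ell2_inner_summable:
  assumes "a \<in> ell2" "b \<in> ell2"
  shows "(\<lambda>i. a i * cnj (b i)) summable_on UNIV"
  using ell2_product_abs_summable[OF assms(1) ell2_cnj[OF assms(2)]]
  by (rule abs_summable_summable)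

lemma ell2_lincomb:
  assumes "a \<in> ell2" "b \<in> ell2"
  shows "(\<lambda>i. a i + t * b i) \<in> ell2"
proof -
  have "(\<lambda>i. 2 * (cmod (a i))\<^sup>2 + 2 * (cmod t)\<^sup>2 * (cmod (b i))\<^sup>2) summable_on UNIV"
    using assms by (intro summable_on_add summable_on_cmult_right) (auto simp: ell2_def)
  then have "(\<lambda>i. (cmod (a i + t * b i))\<^sup>2) summable_on UNIV"
  proof (rule summable_on_comparison_test)
    fix i
    have "(cmod (a i + t * b i))\<^sup>2 \<le> (cmod (a i) + cmod t * cmod (b i))\<^sup>2"
      using norm_triangle_ineq[of "a i" "t * b i"] by (intro power_mono) (auto simp: norm_mult)
    also have "\<dots> \<le> 2 * (cmod (a i))\<^sup>2 + 2 * (cmod t * cmod (b i))\<^sup>2"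
      using sum_squares_bound[of "cmod (a i)" "cmod t * cmod (b i)"] by (simp add: power2_sum)
    finally show "(cmod (a i + t * b i))\<^sup>2 \<le> 2 * (cmod (a i))\<^sup>2 + 2 * (cmod t)\<^sup>2 * (cmod (b i))\<^sup>2"
      by (simp add: power_mult_distrib)
  qed auto
  then show ?thesis by (simp add: ell2_def)
qed

lemma ell2_scale: "a \<in> ell2 \<Longrightarrow> (\<lambda>i. t * a i) \<in> ell2"
  using ell2_lincomb[OF ell2_0, of a t] by simp

lemma ell2_diff: "a \<in> ell2 \<Longrightarrow> b \<in> ell2 \<Longrightarrow> (\<lambda>i. a i - b i) \<in> ell2"
  using ell2_lincomb[of a b "-1"] by simp

lemma ell2_sum:
  assumes "\<And>j. j \<in> J \<Longrightarrow> a j \<in> ell2"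
  shows "(\<lambda>i. \<Sum>j\<in>J. c j * a j i) \<in> ell2"
  using assms
proof (induction J rule: infinite_finite_induct)
  case (insert j J)
  then show ?case
    using ell2_lincomb[of "\<lambda>i. \<Sum>j\<in>J. c j * a j i" "a j" "c j"] by (simp add: add.commute)
qed (auto simp: ell2_0)

lemma ell2_inner_lincomb_left:
  assumes "a \<in> ell2" "b \<in> ell2" "d \<in> ell2"
  shows "ell2_inner (\<lambda>i. a i + t * b i) d = ell2_inner a d + t * ell2_inner b d"
proof -
  have "ell2_inner (\<lambda>i. a i + t * b i) d = (\<Sum>\<^sub>\<infinity>i. a i * cnj (d i) + t * (b i * cnj (d i)))"
    unfolding ell2_inner_def by (simp add: algebra_simps)
  also have "\<dots> = ell2_inner a d + t * ell2_inner b d"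
    unfolding ell2_inner_def using assms
    by (subst infsum_add) (auto intro!: ell2_inner_summable summable_on_cmult_right simp: infsum_cmult_right')
  finally show ?thesis .
qed

lemma ell2_inner_commute: "ell2_inner b a = cnj (ell2_inner a b)"
  unfolding ell2_inner_def by (subst infsum_cnj[symmetric]) (simp add: mult.commute)

lemma ell2_inner_lincomb_right:
  assumes "a \<in> ell2" "b \<in> ell2" "d \<in> ell2"
  shows "ell2_inner d (\<lambda>i. a i + t * b i) = ell2_inner d a + cnj t * ell2_inner d b"
  by (subst (1 2 3) ell2_inner_commute) (simp add: ell2_inner_lincomb_left assms)

lemma ell2_inner_self: "ell2_inner a a = of_real (norm_sq a)"
proof -
  have "ell2_inner a a = (\<Sum>\<^sub>\<infinity>i. complex_of_real ((cmod (a i))\<^sup>2))"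
    unfolding ell2_inner_def by (simp add: complex_norm_square[symmetric])
  also have "\<dots> = of_real (norm_sq a)"
    unfolding norm_sq_def
    by (rule infsum_bounded_linear_strong[OF _ bounded_linear_of_real])
      (use summable_on_bounded_linear_iff[OF bounded_linear_of_real bounded_linear_Re] in \<open>auto simp del: of_real_power\<close>)
  finally show ?thesis .
qed

lemma ell2_inner_sum_left:
  assumes "\<And>j. j \<in> J \<Longrightarrow> a j \<in> ell2" "d \<in> ell2"
  shows "ell2_inner (\<lambda>i. \<Sum>j\<in>J. c j * a j i) d = (\<Sum>j\<in>J. c j * ell2_inner (a j) d)"
  using assms
proof (induction J rule: infinite_finite_induct)
  case (insert j J)
  then show ?case
    using ell2_inner_lincomb_left[of "\<lambda>i. \<Sum>j\<in>J. c j * a j i" "a j" d "c j"]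
      ell2_sum[of J a c] by (simp add: add.commute)
qed (auto simp: ell2_inner_def)

lemma ell2_inner_sum_right:
  assumes "\<And>j. j \<in> J \<Longrightarrow> a j \<in> ell2" "d \<in> ell2"
  shows "ell2_inner d (\<lambda>i. \<Sum>j\<in>J. c j * a j i) = (\<Sum>j\<in>J. cnj (c j) * ell2_inner d (a j))"
  by (subst ell2_inner_commute, subst ell2_inner_sum_left) (use assms in \<open>auto simp: ell2_inner_commute[of d]\<close>)

lemma norm_sq_lincomb:
  assumes "a \<in> ell2" "b \<in> ell2"
  shows "norm_sq (\<lambda>i. a i + t * b i) = norm_sq a + 2 * Re (cnj t * ell2_inner a b) + (cmod t)\<^sup>2 * norm_sq b"
proof -
  let ?v = "\<lambda>i. a i + t * b i"
  have "ell2_inner ?v ?v = ell2_inner a a + t * ell2_inner b a + cnj t * (ell2_inner a b + t * ell2_inner b b)"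
    using assms by (simp add: ell2_inner_lincomb_left[OF assms ell2_lincomb[OF assms]] ell2_inner_lincomb_right
        algebra_simps)
  then have "complex_of_real (norm_sq ?v)
      = of_real (norm_sq a) + cnj t * ell2_inner a b + cnj (cnj t * ell2_inner a b) + of_real ((cmod t)\<^sup>2 * norm_sq b)"
    unfolding ell2_inner_self ell2_inner_commute[of b a] of_real_mult complex_norm_square
    by (simp add: algebra_simps)
  then have "Re (complex_of_real (norm_sq (\<lambda>i. a i + t * b i)))
      = Re (of_real (norm_sq a) + cnj t * ell2_inner a b + cnj (cnj t * ell2_inner a b) + of_real ((cmod t)\<^sup>2 * norm_sq b))"
    by (rule arg_cong)
  then show ?thesis by simp
qed

lemma norm_sq_scale: "norm_sq (\<lambda>i. t * a i) = (cmod t)\<^sup>2 * norm_sq a"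
  unfolding norm_sq_def by (simp add: norm_mult power_mult_distrib infsum_cmult_right')

lemma norm_sq_diff:
  assumes "a \<in> ell2" "b \<in> ell2"
  shows "norm_sq (\<lambda>i. a i - b i) = norm_sq a - 2 * Re (ell2_inner a b) + norm_sq b"
  using norm_sq_lincomb[OF assms, of "-1"] by simp

lemma Cauchy_Schwarz_ell2_inner:
  assumes "a \<in> ell2" "b \<in> ell2"
  shows "(cmod (ell2_inner a b))\<^sup>2 \<le> norm_sq a * norm_sq b"
proof (cases "norm_sq b = 0")
  case True
  then have "b = (\<lambda>_. 0)" using assms norm_sq_eq_0D by blast
  then show ?thesis by (simp add: ell2_inner_def norm_sq_0)
next
  case False
  define s where "s = norm_sq b"
  have s: "s > 0" using False norm_sq_nonneg[of b] by (simp add: s_def)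
  \<comment> \<open>The multiple of \<open>b\<close> that brings \<open>a + t b\<close> closest to 0.\<close>
  define t where "t = - ell2_inner a b / of_real s"
  have "cnj t * ell2_inner a b = - of_real ((cmod (ell2_inner a b))\<^sup>2 / s)"
    by (simp add: t_def complex_norm_square mult.commute[of "cnj _"] del: of_real_power)
  then have "Re (cnj t * ell2_inner a b) = - ((cmod (ell2_inner a b))\<^sup>2 / s)"
    by (metis Re_complex_of_real uminus_complex.sel(1))
  moreover have "(cmod t)\<^sup>2 * s = (cmod (ell2_inner a b))\<^sup>2 / s"
    using s by (simp add: t_def norm_divide power_divide power2_eq_square)
  ultimately have "norm_sq (\<lambda>i. a i + t * b i) = norm_sq a - (cmod (ell2_inner a b))\<^sup>2 / s"
    using norm_sq_lincomb[OF assms, of t] by (simp add: s_def)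
  then have "(cmod (ell2_inner a b))\<^sup>2 / s \<le> norm_sq a"
    using norm_sq_nonneg[of "\<lambda>i. a i + t * b i"] by linarith
  then show ?thesis using s by (simp add: s_def field_simps)
qed

text \<open>
  The entrywise limit is the limit in norm: the bound for the differences of two members passes to the
  limit in every finite partial sum.
\<close>
lemma ell2_complete:
  fixes u :: "nat \<Rightarrow> 'i \<Rightarrow> complex"
  assumes u: "\<And>p. u p \<in> ell2"
    and cauchy: "\<And>\<epsilon>. \<epsilon> > 0 \<Longrightarrow> \<exists>N. \<forall>p\<ge>N. \<forall>q\<ge>N. norm_sq (\<lambda>i. u p i - u q i) \<le> \<epsilon>"
  obtains a where "a \<in> ell2" "(\<lambda>p. norm_sq (\<lambda>i. u p i - a i)) \<longlonglongrightarrow> 0"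
proof -
  have "Cauchy (\<lambda>p. u p i)" for i
  proof (rule CauchyI)
    fix \<epsilon> :: real
    assume "\<epsilon> > 0"
    then obtain N where N: "\<forall>p\<ge>N. \<forall>q\<ge>N. norm_sq (\<lambda>i. u p i - u q i) \<le> (\<epsilon> / 2)\<^sup>2"
      using cauchy[of "(\<epsilon> / 2)\<^sup>2"] by (elim meta_impE exE) simp_all
    have "cmod (u p i - u q i) < \<epsilon>" if "p \<ge> N" "q \<ge> N" for p q
    proof -
      have "(cmod (u p i - u q i))\<^sup>2 \<le> (\<epsilon> / 2)\<^sup>2"
        by (rule order_trans[OF entry_le_norm_sq[OF ell2_diff[OF u u]]]) (use N that in simp)
      then have "cmod (u p i - u q i) \<le> \<epsilon> / 2" using \<open>\<epsilon> > 0\<close> by (simp add: power2_le_iff_abs_le)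
      then show ?thesis using \<open>\<epsilon> > 0\<close> by linarith
    qed
    then show "\<exists>M. \<forall>m\<ge>M. \<forall>n\<ge>M. norm (u m i - u n i) < \<epsilon>" by blast
  qed
  then have "\<exists>l. (\<lambda>p. u p i) \<longlonglongrightarrow> l" for i
    by (simp add: Cauchy_convergent_iff convergent_def)
  then obtain a where a: "(\<lambda>p. u p i) \<longlonglongrightarrow> a i" for i by metis
  have close: "(\<lambda>i. u q i - a i) \<in> ell2 \<and> norm_sq (\<lambda>i. u q i - a i) \<le> \<epsilon>"
    if N: "\<forall>p\<ge>N. \<forall>q\<ge>N. norm_sq (\<lambda>i. u p i - u q i) \<le> \<epsilon>" and q: "q \<ge> N" for N q \<epsilon>
  proof -
    have "(\<Sum>i\<in>F. (cmod (u q i - a i))\<^sup>2) \<le> \<epsilon>" if "finite F" for F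
    proof (rule tendsto_upperbound)
      show "(\<lambda>p. \<Sum>i\<in>F. (cmod (u q i - u p i))\<^sup>2) \<longlonglongrightarrow> (\<Sum>i\<in>F. (cmod (u q i - a i))\<^sup>2)"
        by (intro tendsto_intros a)
      show "\<forall>\<^sub>F p in sequentially. (\<Sum>i\<in>F. (cmod (u q i - u p i))\<^sup>2) \<le> \<epsilon>"
        using eventually_ge_at_top[of N]
      proof eventually_elim
        case (elim p)
        then show ?case
          by (intro order_trans[OF sum_le_norm_sq[OF ell2_diff[OF u u] that]]) (use N q in simp)
      qed
    qed simp
    then show ?thesis by (intro conjI ell2_boundedI)
  qed
  have aell: "a \<in> ell2"
  proof -
    obtain N where "\<forall>p\<ge>N. \<forall>q\<ge>N. norm_sq (\<lambda>i. u p i - u q i) \<le> 1"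
      using cauchy[OF zero_less_one] by (elim exE)
    then have "(\<lambda>i. u N i - a i) \<in> ell2" by (rule conjunct1[OF close]) simp
    from ell2_diff[OF u[of N] this] show ?thesis by simp
  qed
  have "(\<lambda>p. norm_sq (\<lambda>i. u p i - a i)) \<longlonglongrightarrow> 0"
  proof (rule LIMSEQ_I)
    fix r :: real assume "r > 0"
    then obtain N where N: "\<forall>p\<ge>N. \<forall>q\<ge>N. norm_sq (\<lambda>i. u p i - u q i) \<le> r / 2"
      using cauchy[OF half_gt_zero[OF \<open>r > 0\<close>]] by (elim exE)
    have "norm (norm_sq (\<lambda>i. u n i - a i) - 0) < r" if "n \<ge> N" for n
      using conjunct2[OF close[OF N that]] norm_sq_nonneg[of "\<lambda>i. u n i - a i"] \<open>r > 0\<close> by simp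
    then show "\<exists>no. \<forall>n\<ge>no. norm (norm_sq (\<lambda>i. u n i - a i) - 0) < r" by (intro exI allI impI)
  qed
  with aell show ?thesis using that by blast
qed

lemma tendsto_ell2_inner:
  assumes "\<And>p. u p \<in> ell2" "a \<in> ell2" "d \<in> ell2"
    and lim: "(\<lambda>p. norm_sq (\<lambda>i. u p i - a i)) \<longlonglongrightarrow> 0"
  shows "(\<lambda>p. ell2_inner d (u p)) \<longlonglongrightarrow> ell2_inner d a"
proof -
  have "(\<lambda>p. sqrt (norm_sq d * norm_sq (\<lambda>i. u p i - a i))) \<longlonglongrightarrow> sqrt (norm_sq d * 0)"
    by (intro tendsto_intros lim)
  then have lim': "(\<lambda>p. sqrt (norm_sq d * norm_sq (\<lambda>i. u p i - a i))) \<longlonglongrightarrow> 0" by simp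
  have "cmod (ell2_inner d (u p) - ell2_inner d a) \<le> sqrt (norm_sq d * norm_sq (\<lambda>i. u p i - a i))" for p
  proof -
    have "ell2_inner d (u p) - ell2_inner d a = ell2_inner d (\<lambda>i. u p i - a i)"
      using ell2_inner_lincomb_right[OF assms(1)[of p] assms(2,3), of "-1"] by simp
    then show ?thesis
      using Cauchy_Schwarz_ell2_inner[OF assms(3) ell2_diff[OF assms(1)[of p] assms(2)]]
      by (simp add: real_le_rsqrt)
  qed
  then have "(\<lambda>p. ell2_inner d (u p) - ell2_inner d a) \<longlonglongrightarrow> 0"
    by (intro Lim_null_comparison[OF _ lim']) auto
  then show ?thesis by (simp add: LIM_zero_iff)
qed

lemma tendsto_norm_sq:
  assumes u: "\<And>p. u p \<in> ell2" and a: "a \<in> ell2"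
    and lim: "(\<lambda>p. norm_sq (\<lambda>i. u p i - a i)) \<longlonglongrightarrow> 0"
  shows "(\<lambda>p. norm_sq (u p)) \<longlonglongrightarrow> norm_sq a"
proof -
  have eq: "norm_sq (u p) = norm_sq (\<lambda>i. u p i - a i) + 2 * Re (ell2_inner a (u p)) - norm_sq a" for p
    using norm_sq_diff[OF u[of p] a] ell2_inner_commute[of a "u p"] by simp
  have "(\<lambda>p. norm_sq (\<lambda>i. u p i - a i) + 2 * Re (ell2_inner a (u p)) - norm_sq a)
      \<longlonglongrightarrow> 0 + 2 * Re (ell2_inner a a) - norm_sq a"
    by (intro tendsto_intros lim tendsto_ell2_inner u a)
  then show ?thesis by (simp add: eq ell2_inner_self)
qed

section \<open>Riesz representation on a subspace\<close>

text \<open>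
  The subspace on which the functional is given is the image of a space \<open>D\<close> of parameters under a linear
  map \<open>u\<close>; it is not assumed to be closed. Up to a constant, \<open>\<parallel>v\<parallel>\<^sup>2 - 2 Re (L v)\<close> is the squared distance from
  \<open>v\<close> to the representing vector, so a sequence that minimises this quantity on the subspace must converge to it.
  The parallelogram law shows that the sequence is Cauchy.
\<close>
lemma Riesz_representation:
  fixes u :: "('x \<Rightarrow> complex) \<Rightarrow> 'i \<Rightarrow> complex" and L :: "('x \<Rightarrow> complex) \<Rightarrow> complex"
  assumes zero: "(\<lambda>_. 0) \<in> D"
    and D: "\<And>c d t. c \<in> D \<Longrightarrow> d \<in> D \<Longrightarrow> (\<lambda>x. c x + t * d x) \<in> D"
    and u_ell2: "\<And>c. c \<in> D \<Longrightarrow> u c \<in> ell2"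
    and u_lin: "\<And>c d t. c \<in> D \<Longrightarrow> d \<in> D \<Longrightarrow> u (\<lambda>x. c x + t * d x) = (\<lambda>i. u c i + t * u d i)"
    and L_lin: "\<And>c d t. c \<in> D \<Longrightarrow> d \<in> D \<Longrightarrow> L (\<lambda>x. c x + t * d x) = L c + t * L d"
    and bound: "\<And>c. c \<in> D \<Longrightarrow> cmod (L c) \<le> C * sqrt (norm_sq (u c))" and C: "C \<ge> 0"
  obtains a where "a \<in> ell2" "norm_sq a \<le> C\<^sup>2" "\<And>c. c \<in> D \<Longrightarrow> ell2_inner (u c) a = L c"
proof -
  define J where "J = (\<lambda>c. norm_sq (u c) - 2 * Re (L c))"
  have J_lower: "- (C\<^sup>2) \<le> J c" if "c \<in> D" for c
  proof -
    have "Re (L c) \<le> C * sqrt (norm_sq (u c))"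
      using bound[OF that] complex_Re_le_cmod[of "L c"] by linarith
    moreover have "0 \<le> (sqrt (norm_sq (u c)) - C)\<^sup>2" by simp
    then have "2 * (C * sqrt (norm_sq (u c))) \<le> norm_sq (u c) + C\<^sup>2"
      using norm_sq_nonneg[of "u c"] by (simp add: power2_diff algebra_simps)
    ultimately show ?thesis by (simp add: J_def)
  qed
  define m where "m = Inf (J ` D)"
  have bdd: "bdd_below (J ` D)" using J_lower by (auto intro!: bdd_belowI2)
  have m_le: "m \<le> J c" if "c \<in> D" for c
    unfolding m_def using bdd that by (intro cInf_lower) auto
  have "\<exists>c\<in>D. J c < m + 1 / real (Suc p)" for p
  proof -
    have "Inf (J ` D) < m + 1 / real (Suc p)" by (simp add: m_def)
    then show ?thesis using cInf_lessD[of "J ` D"] zero by blast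
  qed
  then obtain c where cD: "c p \<in> D" and cJ: "J (c p) < m + 1 / real (Suc p)" for p by metis
  note cu = u_ell2[OF cD]
  have inv_lim: "(\<lambda>p. 1 / real (Suc p)) \<longlonglongrightarrow> 0"
    using LIMSEQ_inverse_real_of_nat by (simp add: inverse_eq_divide)
  have par: "norm_sq (\<lambda>i. u (c p) i - u (c q) i) \<le> 2 / real (Suc p) + 2 / real (Suc q)" for p q
  proof -
    \<comment> \<open>The midpoint of \<open>c p\<close> and \<open>c q\<close>, written with the single closure operation of \<open>D\<close>.\<close>
    define w where "w = (\<lambda>x. c p x + (1/2) * (c q x + (-1) * c p x))"
    have d: "(\<lambda>x. c q x + (-1) * c p x) \<in> D" by (rule D[OF cD cD])
    have wD: "w \<in> D" unfolding w_def by (rule D[OF cD d])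
    have uw: "u w = (\<lambda>i. u (c p) i + (1/2) * (u (c q) i - u (c p) i))"
      unfolding w_def by (subst u_lin[OF cD d], subst u_lin[OF cD cD]) simp
    have Lw: "L w = L (c p) + (1/2) * (L (c q) - L (c p))"
      unfolding w_def by (subst L_lin[OF cD d], subst L_lin[OF cD cD]) simp
    have Jw: "m \<le> J w" by (rule m_le[OF wD])
    have "norm_sq (u w) = norm_sq (u (c p)) + Re (ell2_inner (u (c p)) (\<lambda>i. u (c q) i - u (c p) i))
        + (1/4) * norm_sq (\<lambda>i. u (c q) i - u (c p) i)"
      unfolding uw using norm_sq_lincomb[OF cu ell2_diff[OF cu cu], of p "1/2" q p]
      by (simp add: power2_eq_square)
    moreover have "ell2_inner (u (c p)) (\<lambda>i. u (c q) i - u (c p) i)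
        = ell2_inner (u (c p)) (u (c q)) - of_real (norm_sq (u (c p)))"
      using ell2_inner_lincomb_right[OF cu cu cu, of p q "-1" p] by (simp add: ell2_inner_self)
    moreover have "norm_sq (\<lambda>i. u (c q) i - u (c p) i) = norm_sq (\<lambda>i. u (c p) i - u (c q) i)"
      by (simp add: norm_sq_def norm_minus_commute)
    moreover note norm_sq_diff[OF cu cu, of p q]
    ultimately have "norm_sq (\<lambda>i. u (c p) i - u (c q) i) = 2 * J (c p) + 2 * J (c q) - 4 * J w"
      by (simp add: J_def Lw algebra_simps)
    then have "norm_sq (\<lambda>i. u (c p) i - u (c q) i) \<le> 2 * (1 / real (Suc p)) + 2 * (1 / real (Suc q))"
      using cJ[of p] cJ[of q] Jw by linarith
    then show ?thesis by simp
  qed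
  obtain a where a: "a \<in> ell2" and lim: "(\<lambda>p. norm_sq (\<lambda>i. u (c p) i - a i)) \<longlonglongrightarrow> 0"
  proof (rule ell2_complete[where u = "\<lambda>p. u (c p)"])
    show "u (c p) \<in> ell2" for p by (rule cu)
    fix \<epsilon> :: real assume "\<epsilon> > 0"
    then have "\<forall>\<^sub>F p in sequentially. 1 / real (Suc p) < \<epsilon> / 4"
      using inv_lim by (intro order_tendstoD) auto
    then obtain N where N: "1 / real (Suc p) < \<epsilon> / 4" if "p \<ge> N" for p
      by (auto simp: eventually_sequentially)
    have "norm_sq (\<lambda>i. u (c p) i - u (c q) i) \<le> \<epsilon>" if "p \<ge> N" "q \<ge> N" for p q
      using par[of p q] N[OF that(1)] N[OF that(2)] by simp
    then show "\<exists>N. \<forall>p\<ge>N. \<forall>q\<ge>N. norm_sq (\<lambda>i. u (c p) i - u (c q) i) \<le> \<epsilon>" by blast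
  qed
  \<comment> \<open>First variation at the limit of the minimising sequence in the direction \<open>u d\<close>.\<close>
  have var: "0 \<le> 2 * t * (Re (ell2_inner (u d) a) - Re (L d)) + t\<^sup>2 * norm_sq (u d)" if d: "d \<in> D" for d t
  proof -
    have "- (1 / real (Suc p)) \<le> 2 * t * (Re (ell2_inner (u d) (u (c p))) - Re (L d)) + t\<^sup>2 * norm_sq (u d)" for p
    proof -
      have "m \<le> J (\<lambda>x. c p x + of_real t * d x)" by (rule m_le[OF D[OF cD d]])
      also have "\<dots> = J (c p) + 2 * t * (Re (ell2_inner (u (c p)) (u d)) - Re (L d)) + t\<^sup>2 * norm_sq (u d)"
        unfolding J_def u_lin[OF cD d] L_lin[OF cD d] norm_sq_lincomb[OF cu u_ell2[OF d]]
        by (simp add: algebra_simps)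
      finally show ?thesis using cJ[of p] ell2_inner_commute[of "u (c p)" "u d"] by simp
    qed
    moreover have "(\<lambda>p. 2 * t * (Re (ell2_inner (u d) (u (c p))) - Re (L d)) + t\<^sup>2 * norm_sq (u d))
        \<longlonglongrightarrow> 2 * t * (Re (ell2_inner (u d) a) - Re (L d)) + t\<^sup>2 * norm_sq (u d)"
      by (intro tendsto_intros tendsto_ell2_inner cu a u_ell2[OF d] lim)
    moreover have "(\<lambda>p. - (1 / real (Suc p))) \<longlonglongrightarrow> - 0" by (intro tendsto_intros inv_lim)
    ultimately have "- 0 \<le> 2 * t * (Re (ell2_inner (u d) a) - Re (L d)) + t\<^sup>2 * norm_sq (u d)"
      by (intro LIMSEQ_le[where X = "\<lambda>p. - (1 / real (Suc p))"]) auto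
    then show ?thesis by simp
  qed
  have Re_eq: "Re (ell2_inner (u d) a) = Re (L d)" if d: "d \<in> D" for d
  proof (rule ccontr)
    define r where "r = Re (ell2_inner (u d) a) - Re (L d)"
    define N where "N = norm_sq (u d) + 1"
    assume "\<not> ?thesis"
    then have r: "r \<noteq> 0" by (simp add: r_def)
    have N: "N > 0" using norm_sq_nonneg[of "u d"] by (simp add: N_def)
    \<comment> \<open>\<open>N\<close> exceeds \<open>norm_sq (u d)\<close>, so the linear term wins at \<open>t = - r / N\<close>.\<close>
    have "0 \<le> 2 * (- r / N) * r + (- r / N)\<^sup>2 * (N - 1)"
      using var[OF d, of "- r / N"] by (simp add: r_def N_def)
    also have "\<dots> = - (r\<^sup>2 * (N + 1)) / N\<^sup>2"
      using N by (simp add: field_simps power2_eq_square)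
    also have "\<dots> < 0" using r N by (intro divide_neg_pos) auto
    finally show False by simp
  qed
  have ell2_inner_eq: "ell2_inner (u d) a = L d" if d: "d \<in> D" for d
  proof (rule complex_eqI)
    show "Re (ell2_inner (u d) a) = Re (L d)" by (rule Re_eq[OF d])
    have "u (\<lambda>_. 0) i = 0" for i using fun_cong[OF u_lin[OF zero zero, of 1], of i] by simp
    then have u0: "u (\<lambda>_. 0) = (\<lambda>_. 0)" by blast
    have L0: "L (\<lambda>_. 0) = 0" using L_lin[OF zero zero, of 1] by simp
    \<comment> \<open>The imaginary part at \<open>d\<close> is the real part at \<open>- \<i> d\<close>.\<close>
    have iD: "(\<lambda>x. 0 + (-\<i>) * d x) \<in> D" by (rule D[OF zero d])
    have "ell2_inner (u (\<lambda>x. 0 + (-\<i>) * d x)) a = ell2_inner (\<lambda>_. 0) a + (-\<i>) * ell2_inner (u d) a"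
      unfolding u_lin[OF zero d] u0 by (rule ell2_inner_lincomb_left[OF ell2_0 u_ell2[OF d] a])
    moreover have "L (\<lambda>x. 0 + (-\<i>) * d x) = (-\<i>) * L d"
      unfolding L_lin[OF zero d] L0 by simp
    moreover have "ell2_inner (\<lambda>_. 0) a = 0" by (simp add: ell2_inner_def)
    ultimately show "Im (ell2_inner (u d) a) = Im (L d)"
      using Re_eq[OF iD] by simp
  qed
  have "norm_sq a \<le> C\<^sup>2"
  proof -
    have le: "Re (ell2_inner a (u (c p))) \<le> C * sqrt (norm_sq (u (c p)))" for p
    proof -
      have "Re (ell2_inner a (u (c p))) = Re (L (c p))"
        using Re_eq[OF cD[of p]] ell2_inner_commute[of a "u (c p)"] by simp
      then show ?thesis using bound[OF cD[of p]] complex_Re_le_cmod[of "L (c p)"] by linarith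
    qed
    have "(\<lambda>p. Re (ell2_inner a (u (c p)))) \<longlonglongrightarrow> Re (ell2_inner a a)"
      by (intro tendsto_intros tendsto_ell2_inner cu a lim)
    moreover have "(\<lambda>p. C * sqrt (norm_sq (u (c p)))) \<longlonglongrightarrow> C * sqrt (norm_sq a)"
      by (intro tendsto_intros tendsto_norm_sq cu a lim)
    ultimately have "Re (ell2_inner a a) \<le> C * sqrt (norm_sq a)"
      using le by (intro LIMSEQ_le) auto
    then have *: "sqrt (norm_sq a) * sqrt (norm_sq a) \<le> C * sqrt (norm_sq a)"
      using norm_sq_nonneg[of a] by (simp add: ell2_inner_self)
    have "sqrt (norm_sq a) \<le> C"
    proof (cases "sqrt (norm_sq a) = 0")
      case False
      then have "sqrt (norm_sq a) > 0" using norm_sq_nonneg[of a] by simp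
      with * show ?thesis by (rule mult_right_le_imp_le)
    qed (use C in auto)
    then show ?thesis using sqrt_le_D by blast
  qed
  with a ell2_inner_eq show ?thesis using that by blast
qed

section \<open>Reproducing kernel spaces with a given basis\<close>

lemma positive_kernel_finite_set:
  assumes K: "positive_kernel X K" and Y: "finite Y" "Y \<subseteq> X"
  shows "(\<Sum>x\<in>Y. \<Sum>y\<in>Y. cnj (c x) * K x y * c y) \<in> \<real>\<^sub>\<ge>\<^sub>0"
proof -
  obtain h where h: "bij_betw h {..<card Y} Y"
    using ex_bij_betw_nat_finite[OF Y(1)] by (auto simp: lessThan_atLeast0)
  have "(\<Sum>i<card Y. \<Sum>j<card Y. cnj (c (h i)) * K (h i) (h j) * c (h j)) \<in> \<real>\<^sub>\<ge>\<^sub>0"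
    using K[unfolded positive_kernel_def, rule_format, of "card Y" h "\<lambda>i. c (h i)"]
      bij_betwE[OF h] Y(2) by auto
  also have "(\<Sum>i<card Y. \<Sum>j<card Y. cnj (c (h i)) * K (h i) (h j) * c (h j))
      = (\<Sum>i<card Y. \<Sum>y\<in>Y. cnj (c (h i)) * K (h i) y * c y)"
    by (intro sum.cong refl sum.reindex_bij_betw[OF h])
  also have "\<dots> = (\<Sum>x\<in>Y. \<Sum>y\<in>Y. cnj (c x) * K x y * c y)"
    by (rule sum.reindex_bij_betw[OF h])
  finally show ?thesis .
qed

lemma mult_op_scale: "mult_op \<phi> (\<lambda>x. t * f x) = (\<lambda>x. t * mult_op \<phi> f x)"
  by (simp add: mult_op_def mult_ac)

text \<open>
  The vector \<open>(e\<^sub>i(x))\<^sub>i\<close> is the usual feature vector of the point \<open>x\<close>. Functions vanish outside \<open>X\<close>, as the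
  elements of the spaces in the theorem do.
\<close>
locale feature_space =
  fixes X :: "'x set" and e :: "'i \<Rightarrow> 'x \<Rightarrow> complex"
  assumes feature_ell2: "x \<in> X \<Longrightarrow> (\<lambda>i. e i x) \<in> ell2"
begin

definition ev :: "('i \<Rightarrow> complex) \<Rightarrow> 'x \<Rightarrow> complex" where
  "ev a = (\<lambda>x. if x \<in> X then \<Sum>\<^sub>\<infinity>i. a i * e i x else 0)"

definition kernel_vec :: "'x \<Rightarrow> 'i \<Rightarrow> complex" where
  "kernel_vec x = (\<lambda>i. cnj (e i x))"

definition kernel :: "'x \<Rightarrow> 'x \<Rightarrow> complex" where
  "kernel x y = ell2_inner (kernel_vec y) (kernel_vec x)"

lemma kernel_vec_ell2: "x \<in> X \<Longrightarrow> kernel_vec x \<in> ell2"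
  unfolding kernel_vec_def by (intro ell2_cnj feature_ell2)

lemma ev_eq_ell2_inner: "x \<in> X \<Longrightarrow> ev a x = ell2_inner a (kernel_vec x)"
  by (simp add: ev_def ell2_inner_def kernel_vec_def)

lemma ev_outside: "x \<notin> X \<Longrightarrow> ev a x = 0"
  by (simp add: ev_def)

lemma ev_lincomb:
  assumes "a \<in> ell2" "b \<in> ell2"
  shows "ev (\<lambda>i. a i + t * b i) = (\<lambda>x. ev a x + t * ev b x)"
proof
  fix x
  show "ev (\<lambda>i. a i + t * b i) x = ev a x + t * ev b x"
    by (cases "x \<in> X") (simp_all add: ev_outside ev_eq_ell2_inner ell2_inner_lincomb_left assms kernel_vec_ell2)
qed

lemma ev_scale:
  assumes "a \<in> ell2"
  shows "ev (\<lambda>i. t * a i) = (\<lambda>x. t * ev a x)"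
proof -
  have "ev (\<lambda>_. 0) = (\<lambda>_. 0)" by (auto simp: ev_def)
  then show ?thesis using ev_lincomb[OF ell2_0 assms, of t] by simp
qed

lemma inj_on_evI:
  assumes "\<And>a. a \<in> ell2 \<Longrightarrow> (\<And>x. x \<in> X \<Longrightarrow> ev a x = 0) \<Longrightarrow> a = (\<lambda>_. 0)"
  shows "inj_on ev ell2"
proof
  fix a b assume a: "a \<in> ell2" and b: "b \<in> ell2" and eq: "ev a = ev b"
  have "(\<lambda>i. a i - b i) = (\<lambda>_. 0)"
    using ev_lincomb[OF a b, of "-1"] by (intro assms ell2_diff a b) (simp add: eq)
  then show "a = b" by (auto simp: fun_eq_iff)
qed

lemma cmod_ev_le:
  assumes "a \<in> ell2" "x \<in> X"
  shows "cmod (ev a x) \<le> sqrt (norm_sq a) * sqrt (norm_sq (kernel_vec x))"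
proof -
  have "(cmod (ev a x))\<^sup>2 \<le> norm_sq a * norm_sq (kernel_vec x)"
    using Cauchy_Schwarz_ell2_inner[OF assms(1) kernel_vec_ell2[OF assms(2)]] by (simp add: ev_eq_ell2_inner assms)
  then show ?thesis unfolding real_sqrt_mult[symmetric] by (rule real_le_rsqrt)
qed

text \<open>
  The points are given as a family over an arbitrary index set, so that both the lists of points in
  \<^const>\<open>positive_kernel\<close>, which may have repetitions, and finite sets of points are covered.
\<close>
definition kernel_comb :: "'j set \<Rightarrow> ('j \<Rightarrow> complex) \<Rightarrow> ('j \<Rightarrow> 'x) \<Rightarrow> 'i \<Rightarrow> complex" where
  "kernel_comb J c x = (\<lambda>i. \<Sum>j\<in>J. c j * kernel_vec (x j) i)"

lemma kernel_comb_ell2: "(\<And>j. j \<in> J \<Longrightarrow> x j \<in> X) \<Longrightarrow> kernel_comb J c x \<in> ell2"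
  unfolding kernel_comb_def by (intro ell2_sum kernel_vec_ell2)

lemma ell2_inner_kernel_comb:
  assumes "a \<in> ell2" "\<And>j. j \<in> J \<Longrightarrow> x j \<in> X"
  shows "ell2_inner a (kernel_comb J c x) = (\<Sum>j\<in>J. cnj (c j) * ev a (x j))"
  unfolding kernel_comb_def using assms by (subst ell2_inner_sum_right) (auto intro: kernel_vec_ell2 simp: ev_eq_ell2_inner)

lemma norm_sq_kernel_comb:
  assumes "\<And>j. j \<in> J \<Longrightarrow> x j \<in> X"
  shows "complex_of_real (norm_sq (kernel_comb J c x))
    = (\<Sum>i\<in>J. \<Sum>j\<in>J. cnj (c i) * kernel (x i) (x j) * c j)"
proof -
  have "complex_of_real (norm_sq (kernel_comb J c x)) = (\<Sum>i\<in>J. cnj (c i) * ell2_inner (kernel_comb J c x) (kernel_vec (x i)))"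
    unfolding ell2_inner_self[symmetric] using assms
    by (subst ell2_inner_kernel_comb) (auto simp: kernel_comb_ell2 ev_eq_ell2_inner)
  also have "\<dots> = (\<Sum>i\<in>J. cnj (c i) * (\<Sum>j\<in>J. c j * kernel (x i) (x j)))"
    unfolding kernel_comb_def kernel_def
    by (intro sum.cong refl arg_cong2[where f = times] ell2_inner_sum_left kernel_vec_ell2 assms)
  finally show ?thesis by (simp add: sum_distrib_left mult_ac)
qed

text \<open>
  The combination with the coefficients \<open>c\<^sub>j S(x\<^sub>j)\<^sup>*\<close> is the image of the one with the coefficients \<open>c\<^sub>j\<close> under
  the adjoint of multiplication by \<open>S\<close>.
\<close>
lemma kernel_quadratic_form:
  assumes "\<And>j. j \<in> J \<Longrightarrow> x j \<in> X"
  shows "(\<Sum>i\<in>J. \<Sum>j\<in>J. cnj (c i) * ((1 - S (x i) * cnj (S (x j))) * kernel (x i) (x j)) * c j)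
    = of_real (norm_sq (kernel_comb J c x) - norm_sq (kernel_comb J (\<lambda>j. c j * cnj (S (x j))) x))"
  unfolding of_real_diff using assms
  by (simp add: norm_sq_kernel_comb sum_subtractf[symmetric] algebra_simps)

section \<open>Multipliers and positive kernels\<close>

text \<open>
  With \<open>v = M\<^sub>S\<^sup>* u\<close>, the adjoint is contractive because
  \<open>\<parallel>v\<parallel>\<^sup>2 = \<langle>M\<^sub>S v, u\<rangle> \<le> \<parallel>v\<parallel> \<parallel>u\<parallel>\<close>.
\<close>
lemma positive_kernel_if_contractive_multiplier:
  assumes mult: "\<And>a. a \<in> ell2 \<Longrightarrow>
    \<exists>b\<in>ell2. (\<forall>x\<in>X. ev b x = S x * ev a x) \<and> norm_sq b \<le> norm_sq a"
  shows "positive_kernel X (\<lambda>x y. (1 - S x * cnj (S y)) * kernel x y)"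
  unfolding positive_kernel_def
proof (intro allI impI)
  fix n :: nat and x :: "nat \<Rightarrow> 'x" and c :: "nat \<Rightarrow> complex"
  assume x: "\<forall>i<n. x i \<in> X"
  define u where "u = kernel_comb {..<n} c x"
  define v where "v = kernel_comb {..<n} (\<lambda>j. c j * cnj (S (x j))) x"
  have u: "u \<in> ell2" and v: "v \<in> ell2" using x by (auto simp: u_def v_def intro!: kernel_comb_ell2)
  obtain w where w: "w \<in> ell2" "\<forall>x\<in>X. ev w x = S x * ev v x" "norm_sq w \<le> norm_sq v"
    using mult[OF v] by blast
  have "ell2_inner w u = (\<Sum>j<n. cnj (c j) * ev w (x j))"
    unfolding u_def using x by (intro ell2_inner_kernel_comb w) auto
  also have "\<dots> = (\<Sum>j<n. cnj (c j * cnj (S (x j))) * ev v (x j))"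
    using x w(2) by (intro sum.cong) auto
  also have "\<dots> = ell2_inner v v"
    by (subst (2) v_def, subst ell2_inner_kernel_comb) (use v x in auto)
  finally have "ell2_inner w u = of_real (norm_sq v)" by (simp add: ell2_inner_self)
  then have "(norm_sq v)\<^sup>2 \<le> norm_sq w * norm_sq u"
    using Cauchy_Schwarz_ell2_inner[OF w(1) u] by simp
  also have "\<dots> \<le> norm_sq v * norm_sq u" by (intro mult_right_mono w norm_sq_nonneg)
  finally have sq: "norm_sq v * norm_sq v \<le> norm_sq v * norm_sq u" by (simp add: power2_eq_square)
  have "norm_sq v \<le> norm_sq u"
  proof (cases "norm_sq v = 0")
    case False
    then have "norm_sq v > 0" using norm_sq_nonneg[of v] by simp
    with sq show ?thesis by simp
  qed (simp add: norm_sq_nonneg)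
  moreover have "(\<Sum>i<n. \<Sum>j<n. cnj (c i) * ((1 - S (x i) * cnj (S (x j))) * kernel (x i) (x j)) * c j)
      = of_real (norm_sq u - norm_sq v)"
    unfolding u_def v_def by (rule kernel_quadratic_form) (use x in auto)
  ultimately show "(\<Sum>i<n. \<Sum>j<n. cnj (c i) * ((1 - S (x i) * cnj (S (x j))) * kernel (x i) (x j)) * c j)
      \<in> \<real>\<^sub>\<ge>\<^sub>0" by (simp del: of_real_diff)
qed

text \<open>
  An element \<open>b\<close> with the values \<open>S(x) f(x)\<close> must satisfy \<open>\<langle>\<Sum> c\<^sub>x k\<^sub>x, b\<rangle> = \<Sum> c\<^sub>x (S(x) f(x))\<^sup>*\<close>, where
  \<open>k\<^sub>x\<close> is the kernel vector at \<open>x\<close>. The right-hand side is \<open>\<langle>\<Sum> c\<^sub>x S(x)\<^sup>* k\<^sub>x, f\<rangle>\<close>, and positivity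
  bounds its modulus by \<open>\<parallel>f\<parallel> \<parallel>\<Sum> c\<^sub>x k\<^sub>x\<parallel>\<close>; so \<open>b\<close> exists by Riesz representation.
\<close>
lemma contractive_multiplier_if_positive_kernel:
  assumes pos: "positive_kernel X (\<lambda>x y. (1 - S x * cnj (S y)) * kernel x y)"
    and a: "a \<in> ell2"
  obtains b where "b \<in> ell2" "ev b = (\<lambda>x. S x * ev a x)" "norm_sq b \<le> norm_sq a"
proof -
  define supp :: "('x \<Rightarrow> complex) \<Rightarrow> 'x set" where "supp = (\<lambda>c. {x. c x \<noteq> 0})"
  define D where "D = {c. finite (supp c) \<and> supp c \<subseteq> X}"
  define fsum :: "('x \<Rightarrow> complex) \<Rightarrow> ('x \<Rightarrow> complex) \<Rightarrow> complex"
    where "fsum = (\<lambda>c h. \<Sum>x\<in>supp c. c x * h x)"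
  have fsum_lin: "fsum (\<lambda>x. c x + t * d x) h = fsum c h + t * fsum d h"
    if "c \<in> D" "d \<in> D" for c d t h
  proof -
    define Z where "Z = supp c \<union> supp d"
    have Z: "finite Z" using that by (simp add: D_def Z_def)
    have eq: "fsum g h = (\<Sum>x\<in>Z. g x * h x)" if "supp g \<subseteq> Z" for g
      unfolding fsum_def using Z that by (intro sum.mono_neutral_left) (auto simp: supp_def)
    have "supp (\<lambda>x. c x + t * d x) \<subseteq> Z" by (auto simp: Z_def supp_def)
    then show ?thesis
      by (simp add: eq Z_def sum.distrib sum_distrib_left algebra_simps)
  qed
  define u where "u = (\<lambda>c i. fsum c (\<lambda>x. kernel_vec x i))"
  define L where "L = (\<lambda>c. fsum c (\<lambda>x. cnj (S x * ev a x)))"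
  have u_kernel_comb: "u c = kernel_comb (supp c) c id" for c by (simp add: u_def fsum_def kernel_comb_def)
  have bound: "cmod (L c) \<le> sqrt (norm_sq a) * sqrt (norm_sq (u c))" if c: "c \<in> D" for c
  proof -
    have cX: "id x \<in> X" if "x \<in> supp c" for x using c that by (auto simp: D_def)
    \<comment> \<open>The image of \<open>u c\<close> under the adjoint of multiplication by \<open>S\<close>.\<close>
    define v where "v = kernel_comb (supp c) (\<lambda>x. c x * cnj (S (id x))) id"
    have v: "v \<in> ell2" unfolding v_def by (rule kernel_comb_ell2) (rule cX)
    have "ell2_inner a v = cnj (L c)"
      unfolding v_def L_def fsum_def
      by (subst ell2_inner_kernel_comb) (use a cX in \<open>auto simp: mult_ac\<close>)
    then have "(cmod (L c))\<^sup>2 \<le> norm_sq a * norm_sq v"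
      using Cauchy_Schwarz_ell2_inner[OF a v] by simp
    moreover have "norm_sq v \<le> norm_sq (u c)"
    proof -
      have "(\<Sum>x\<in>supp c. \<Sum>y\<in>supp c. cnj (c x) * ((1 - S (id x) * cnj (S (id y))) * kernel (id x) (id y)) * c y) \<in> \<real>\<^sub>\<ge>\<^sub>0"
        unfolding id_apply using c by (intro positive_kernel_finite_set[OF pos]) (auto simp: D_def)
      then have "complex_of_real (norm_sq (u c) - norm_sq v) \<in> \<real>\<^sub>\<ge>\<^sub>0"
        unfolding u_kernel_comb v_def by (subst (asm) kernel_quadratic_form) (use cX in auto)
      then show ?thesis by (simp only: nonneg_Reals_of_real_iff diff_ge_0_iff_ge)
    qed
    ultimately have "(cmod (L c))\<^sup>2 \<le> norm_sq a * norm_sq (u c)"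
      using mult_left_mono[OF _ norm_sq_nonneg[of a]] by (meson order_trans)
    then show ?thesis by (simp add: real_le_rsqrt real_sqrt_mult[symmetric])
  qed
  have D0: "(\<lambda>_. 0) \<in> D" by (simp add: D_def supp_def)
  have D_lin: "(\<lambda>x. c x + t * d x) \<in> D" if "c \<in> D" "d \<in> D" for c d t
  proof -
    have "supp (\<lambda>x. c x + t * d x) \<subseteq> supp c \<union> supp d" by (auto simp: supp_def)
    then show ?thesis using that finite_subset by (auto simp: D_def)
  qed
  have u_ell2: "u c \<in> ell2" if "c \<in> D" for c
    unfolding u_kernel_comb using that by (intro kernel_comb_ell2) (auto simp: D_def)
  have u_lin: "u (\<lambda>x. c x + t * d x) = (\<lambda>i. u c i + t * u d i)" if "c \<in> D" "d \<in> D" for c d t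
    unfolding u_def fsum_lin[OF that] ..
  have L_lin: "L (\<lambda>x. c x + t * d x) = L c + t * L d" if "c \<in> D" "d \<in> D" for c d t
    unfolding L_def fsum_lin[OF that] ..
  have C0: "sqrt (norm_sq a) \<ge> 0" by (simp add: norm_sq_nonneg)
  obtain b where b: "b \<in> ell2" "norm_sq b \<le> (sqrt (norm_sq a))\<^sup>2"
    and rep: "\<And>c. c \<in> D \<Longrightarrow> ell2_inner (u c) b = L c"
  proof (rule Riesz_representation[of D u L "sqrt (norm_sq a)", OF D0 D_lin u_ell2 u_lin L_lin bound C0])
    fix b
    assume "b \<in> ell2" "norm_sq b \<le> (sqrt (norm_sq a))\<^sup>2" "\<And>c. c \<in> D \<Longrightarrow> ell2_inner (u c) b = L c"
    then show thesis by (rule that)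
  qed
  have "ev b x = S x * ev a x" for x
  proof (cases "x \<in> X")
    case True
    \<comment> \<open>Represent the value of the functional at a single kernel vector.\<close>
    define c where "c = (\<lambda>y. if y = x then 1 else 0 :: complex)"
    have supp: "supp c = {x}" by (auto simp: supp_def c_def)
    have "ell2_inner (u c) b = L c" using True by (intro rep) (simp add: D_def supp)
    then have "ell2_inner (kernel_vec x) b = cnj (S x * ev a x)"
      by (simp add: u_def L_def fsum_def supp) (simp add: c_def)
    then show ?thesis
      using True ell2_inner_commute[of b "kernel_vec x"] by (simp add: ev_eq_ell2_inner)
  qed (simp add: ev_outside)
  then have "ev b = (\<lambda>x. S x * ev a x)" ..
  with b show ?thesis using that norm_sq_nonneg[of a] by simp
qed

lemma linear_operator_onI:
  assumes "\<And>a. a \<in> ell2 \<Longrightarrow> T (ev a) = mult_op S (ev a)"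
    and "\<And>a. a \<in> ell2 \<Longrightarrow> \<exists>b\<in>ell2. mult_op S (ev a) = ev b"
  shows "linear_operator_on (ev ` ell2) T"
  unfolding linear_operator_on_def
proof (intro conjI ballI allI)
  fix f assume "f \<in> ev ` ell2"
  then obtain a where a: "a \<in> ell2" "f = ev a" by auto
  then show "T f \<in> ev ` ell2" using assms by auto
  fix t
  have "T (\<lambda>x. t * f x) = mult_op S (\<lambda>x. t * f x)"
    using assms(1)[OF ell2_scale[OF a(1), of t]] by (simp add: a ev_scale)
  then show "T (\<lambda>x. t * f x) = (\<lambda>x. t * T f x)"
    using assms(1)[OF a(1)] by (simp add: a mult_op_scale)
next
  fix f g assume "f \<in> ev ` ell2" "g \<in> ev ` ell2"
  then obtain a b where ab: "a \<in> ell2" "f = ev a" "b \<in> ell2" "g = ev b" by auto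
  have "T (\<lambda>x. f x + g x) = mult_op S (\<lambda>x. f x + g x)"
    using assms(1)[OF ell2_lincomb[OF ab(1,3), of 1]] ev_lincomb[OF ab(1,3), of 1] by (simp add: ab)
  then show "T (\<lambda>x. f x + g x) = (\<lambda>x. T f x + T g x)"
    using assms(1)[OF ab(1)] assms(1)[OF ab(3)] by (simp add: ab mult_op_def distrib_left)
qed

text \<open>
  A multiplication that maps every basis function to a multiple of another one, injectively, acts on
  coefficients as a weighted shift. All coordinate multiplications are of this kind.
\<close>
lemma weighted_shift:
  assumes \<phi>: "inj \<phi>" and r: "\<And>i. cmod (r i) \<le> 1"
    and me: "\<And>i x. x \<in> X \<Longrightarrow> m x * e i x = r i * e (\<phi> i) x"
    and a: "a \<in> ell2"
  obtains b where "b \<in> ell2" "ev b = (\<lambda>x. m x * ev a x)" "norm_sq b \<le> norm_sq a"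
proof -
  define b where "b = (\<lambda>i. if i \<in> range \<phi> then r (inv \<phi> i) * a (inv \<phi> i) else 0)"
  have b\<phi>: "b (\<phi> i) = r i * a i" for i using \<phi> by (simp add: b_def)
  have b0: "b i = 0" if "i \<notin> range \<phi>" for i using that by (simp add: b_def)
  have fin: "(\<Sum>i\<in>F. (cmod (b i))\<^sup>2) \<le> norm_sq a" if "finite F" for F
  proof -
    have "(\<Sum>i\<in>F. (cmod (b i))\<^sup>2) = (\<Sum>i\<in>\<phi> ` (\<phi> -` F). (cmod (b i))\<^sup>2)"
      using that b0 by (intro sum.mono_neutral_right) auto
    also have "\<dots> = (\<Sum>i\<in>\<phi> -` F. (cmod (r i * a i))\<^sup>2)"
      using \<phi> by (subst sum.reindex) (auto simp: b\<phi> inj_on_def)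
    also have "\<dots> \<le> (\<Sum>i\<in>\<phi> -` F. (cmod (a i))\<^sup>2)"
      using r by (intro sum_mono power_mono) (auto simp: norm_mult mult_left_le_one_le)
    also have "\<dots> \<le> norm_sq a"
      using that \<phi> by (intro sum_le_norm_sq a finite_vimageI)
    finally show ?thesis .
  qed
  have "ev b x = m x * ev a x" for x
  proof (cases "x \<in> X")
    case True
    have "(\<Sum>\<^sub>\<infinity>i. b i * e i x) = (\<Sum>\<^sub>\<infinity>i\<in>range \<phi>. b i * e i x)"
      by (rule infsum_cong_neutral) (auto simp: b0)
    also have "\<dots> = (\<Sum>\<^sub>\<infinity>i. m x * (a i * e i x))"
      using \<phi> by (subst infsum_reindex) (auto simp: o_def b\<phi> me[OF True, symmetric] mult_ac intro!: infsum_cong)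
    also have "\<dots> = m x * (\<Sum>\<^sub>\<infinity>i. a i * e i x)"
      by (rule infsum_cmult_right')
    finally show ?thesis using True by (simp add: ev_def)
  qed (simp add: ev_outside)
  then have "ev b = (\<lambda>x. m x * ev a x)" ..
  with ell2_boundedI[OF fin] show ?thesis using that by blast
qed

section \<open>Contractions that are multiplications on a basis\<close>

definition unit :: "'i \<Rightarrow> 'i \<Rightarrow> complex" where
  "unit i = (\<lambda>j. if j = i then 1 else 0)"

lemma unit_ell2: "unit i \<in> ell2"
  by (rule finite_support_ell2[of "{i}"]) (auto simp: unit_def)

lemma ev_unit: "ev (unit i) = (\<lambda>x. if x \<in> X then e i x else 0)"
  unfolding ev_def unit_def by (subst infsum_finite_support[of "{i}"]) auto

lemma ell2_truncation:
  assumes a: "a \<in> ell2" and "\<epsilon> > 0"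
  obtains F where "finite F" "norm_sq (\<lambda>i. a i - (if i \<in> F then a i else 0)) \<le> \<epsilon>"
proof -
  have "(\<lambda>i. (cmod (a i))\<^sup>2) summable_on UNIV" using a by (simp add: ell2_def)
  then obtain F where F: "finite F" "dist (\<Sum>i\<in>F. (cmod (a i))\<^sup>2) (norm_sq a) \<le> \<epsilon>"
    using infsum_finite_approximation[of "\<lambda>i. (cmod (a i))\<^sup>2" UNIV \<epsilon>] \<open>\<epsilon> > 0\<close>
    by (auto simp: norm_sq_def)
  define b where "b = (\<lambda>i. if i \<in> F then a i else 0)"
  have b: "b \<in> ell2" using F(1) by (rule finite_support_ell2) (simp add: b_def)
  have "ell2_inner a b = (\<Sum>i\<in>F. a i * cnj (a i))"
    unfolding ell2_inner_def by (subst infsum_finite_support[OF F(1)]) (auto simp: b_def)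
  also have "\<dots> = of_real (\<Sum>i\<in>F. (cmod (a i))\<^sup>2)"
    by (simp add: complex_norm_square[symmetric] del: of_real_power)
  finally have "Re (ell2_inner a b) = (\<Sum>i\<in>F. (cmod (a i))\<^sup>2)" by simp
  moreover have "norm_sq b = (\<Sum>i\<in>F. (cmod (a i))\<^sup>2)"
    unfolding norm_sq_def by (subst infsum_finite_support[OF F(1)]) (auto simp: b_def)
  ultimately have "norm_sq (\<lambda>i. a i - b i) = norm_sq a - (\<Sum>i\<in>F. (cmod (a i))\<^sup>2)"
    using norm_sq_diff[OF a b] by simp
  then have "norm_sq (\<lambda>i. a i - b i) \<le> \<epsilon>" using F(2) by (simp add: dist_real_def)
  then show ?thesis using that F(1) by (simp add: b_def)
qed

text \<open>
  By linearity \<open>T\<close> multiplies finitely supported vectors by \<open>S\<close>. Writing \<open>a = b + d\<close> with \<open>b\<close> finitely supported and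
  \<open>\<parallel>d\<parallel>\<^sup>2 \<le> \<epsilon>\<close>, the error at \<open>x\<close> comes from \<open>T d\<close> and \<open>S d\<close> alone, and both are small at \<open>x\<close> since evaluation is bounded.
\<close>
lemma contraction_is_multiplier:
  assumes lin: "linear_operator_on (ev ` ell2) T"
    and contr: "\<And>a b. a \<in> ell2 \<Longrightarrow> b \<in> ell2 \<Longrightarrow> T (ev a) = ev b \<Longrightarrow> norm_sq b \<le> norm_sq a"
    and units: "\<And>i. T (ev (unit i)) = (\<lambda>x. S x * ev (unit i) x)"
    and a: "a \<in> ell2"
  shows "T (ev a) = (\<lambda>x. S x * ev a x)"
proof
  fix x
  have T_in: "\<exists>b\<in>ell2. T (ev a) = ev b" if "a \<in> ell2" for a
    using lin that by (auto simp: linear_operator_on_def image_iff)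
  have T_lincomb: "T (ev (\<lambda>i. a i + t * b i)) = (\<lambda>x. T (ev a) x + t * T (ev b) x)"
    if "a \<in> ell2" "b \<in> ell2" for a b t
  proof -
    have add: "\<And>f g. f \<in> ev ` ell2 \<Longrightarrow> g \<in> ev ` ell2 \<Longrightarrow> T (\<lambda>x. f x + g x) = (\<lambda>x. T f x + T g x)"
      and scale: "\<And>f t. f \<in> ev ` ell2 \<Longrightarrow> T (\<lambda>x. t * f x) = (\<lambda>x. t * T f x)"
      using lin by (auto simp: linear_operator_on_def)
    have "ev (\<lambda>i. 0 + t * b i) = (\<lambda>x. ev (\<lambda>_. 0) x + t * ev b x)"
      by (rule ev_lincomb[OF ell2_0 that(2)])
    moreover have "ev (\<lambda>_. 0) = (\<lambda>_. 0)" by (auto simp: ev_def)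
    ultimately have "ev (\<lambda>i. t * b i) = (\<lambda>x. t * ev b x)" by simp
    then have "(\<lambda>x. t * ev b x) \<in> ev ` ell2" using ell2_scale[OF that(2), of t] by (metis imageI)
    then show ?thesis
      unfolding ev_lincomb[OF that] using add[of "ev a" "\<lambda>x. t * ev b x"] scale[of "ev b" t] that
      by simp
  qed
  have finite_support: "T (ev b) = (\<lambda>x. S x * ev b x)"
    if "finite F" "\<And>i. i \<notin> F \<Longrightarrow> b i = 0" for F b
    using that
  proof (induction F arbitrary: b rule: finite_induct)
    case empty
    then have "b = (\<lambda>_. 0)" by auto
    then have dbl: "T (ev b) = (\<lambda>x. T (ev b) x + 1 * T (ev b) x)"
      using T_lincomb[OF ell2_0 ell2_0, of 1] by simp
    have T0: "T (ev b) = (\<lambda>_. 0)"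
    proof
      fix x
      show "T (ev b) x = 0" using fun_cong[OF dbl, of x] by (simp only: mult_1 add_cancel_right_right)
    qed
    have ev0: "ev b = (\<lambda>_. 0)" using \<open>b = (\<lambda>_. 0)\<close> by (auto simp: ev_def)
    show ?case unfolding T0 unfolding ev0 by simp
  next
    case (insert j F)
    define b' where "b' = (\<lambda>i. if i = j then 0 else b i)"
    have "b' i = 0" if "i \<notin> F" for i using insert.prems[of i] that by (simp add: b'_def)
    then have IH: "T (ev b') = (\<lambda>x. S x * ev b' x)" and b': "b' \<in> ell2"
      using insert.IH[of b'] finite_support_ell2[OF insert.hyps(1), of b'] by simp_all
    have b: "b = (\<lambda>i. b' i + b j * unit j i)" by (auto simp: b'_def unit_def)
    have "T (ev b) = (\<lambda>x. T (ev b') x + b j * T (ev (unit j)) x)"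
      using T_lincomb[OF b' unit_ell2, of "b j" j] by (simp only: b[symmetric])
    moreover have "ev b = (\<lambda>x. ev b' x + b j * ev (unit j) x)"
      using ev_lincomb[OF b' unit_ell2, of "b j" j] by (simp only: b[symmetric])
    ultimately show ?case by (simp add: IH units algebra_simps)
  qed
  show "T (ev a) x = S x * ev a x"
  proof (cases "x \<in> X")
    case False
    then show ?thesis using T_in[OF a] by (auto simp: ev_outside)
  next
    case True
    define M where "M = (1 + cmod (S x)) * sqrt (norm_sq (kernel_vec x))"
    have M: "M \<ge> 0" by (simp add: M_def norm_sq_nonneg)
    have le: "cmod (T (ev a) x - S x * ev a x) \<le> sqrt \<epsilon> * M" if "\<epsilon> > 0" for \<epsilon>
    proof -
      obtain F where F: "finite F" "norm_sq (\<lambda>i. a i - (if i \<in> F then a i else 0)) \<le> \<epsilon>"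
        using ell2_truncation[OF a \<open>\<epsilon> > 0\<close>] .
      define b where "b = (\<lambda>i. if i \<in> F then a i else 0)"
      define d where "d = (\<lambda>i. a i - b i)"
      have b: "b \<in> ell2" using F(1) by (rule finite_support_ell2) (simp add: b_def)
      have d: "d \<in> ell2" unfolding d_def by (rule ell2_diff[OF a b])
      have d\<epsilon>: "norm_sq d \<le> \<epsilon>" using F(2) by (simp add: d_def b_def)
      have ad: "(\<lambda>i. b i + 1 * d i) = a" by (simp add: d_def)
      obtain d' where d': "d' \<in> ell2" "T (ev d) = ev d'" using T_in[OF d] by blast
      have "norm_sq d' \<le> norm_sq d" using contr[OF d d'] .
      have Tb: "T (ev b) = (\<lambda>x. S x * ev b x)"
        using F(1) by (rule finite_support) (simp add: b_def)
      have "T (ev a) x - S x * ev a x = ev d' x - S x * ev d x"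
        using T_lincomb[OF b d, of 1] ev_lincomb[OF b d, of 1] unfolding ad Tb d'(2)
        by (simp add: algebra_simps)
      also have "cmod \<dots> \<le> cmod (ev d' x) + cmod (S x) * cmod (ev d x)"
        by (metis norm_mult norm_triangle_ineq4)
      also have "\<dots> \<le> sqrt \<epsilon> * sqrt (norm_sq (kernel_vec x)) + cmod (S x) * (sqrt \<epsilon> * sqrt (norm_sq (kernel_vec x)))"
      proof (intro add_mono mult_left_mono)
        show "cmod (ev d' x) \<le> sqrt \<epsilon> * sqrt (norm_sq (kernel_vec x))"
          using \<open>norm_sq d' \<le> norm_sq d\<close> d\<epsilon>
          by (intro order_trans[OF cmod_ev_le[OF d'(1) True]] mult_right_mono) (auto simp: norm_sq_nonneg)
        show "cmod (ev d x) \<le> sqrt \<epsilon> * sqrt (norm_sq (kernel_vec x))"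
          using d\<epsilon>
          by (intro order_trans[OF cmod_ev_le[OF d True]] mult_right_mono) (auto simp: norm_sq_nonneg)
      qed auto
      finally show ?thesis by (simp add: M_def algebra_simps)
    qed
    have "cmod (T (ev a) x - S x * ev a x) \<le> 0 + \<delta>" if "\<delta> > 0" for \<delta>
    proof -
      have pos: "(\<delta> / (M + 1))\<^sup>2 > 0" using M that by simp
      have "cmod (T (ev a) x - S x * ev a x) \<le> \<delta> / (M + 1) * M"
        using le[OF pos] M that by (simp add: real_sqrt_abs)
      also have "\<dots> \<le> \<delta>" using M that by (simp add: field_simps)
      finally show ?thesis by simp
    qed
    then have "cmod (T (ev a) x - S x * ev a x) \<le> 0" by (rule field_le_epsilon)
    then show ?thesis by simp
  qed
qed

end

section \<open>Uniqueness of the coefficients of a power series\<close>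

text \<open>
  Let \<open>n\<close> be the least base with a nonzero coefficient. Multiplied by \<open>n\<^sup>s\<close>, all the other terms together are
  \<open>O((n / (n + 1))\<^sup>s)\<close>, so this coefficient is arbitrarily small.
\<close>
lemma Dirichlet_coefficients_unique:
  fixes N :: "'i \<Rightarrow> nat" and c :: "'i \<Rightarrow> complex"
  assumes N: "inj N" "\<And>i. N i \<ge> 1"
    and summ: "(\<lambda>i. cmod (c i) / real (N i) ^ s0) summable_on UNIV"
    and zero: "\<And>s. s \<ge> s0 \<Longrightarrow> (\<Sum>\<^sub>\<infinity>i. c i / of_nat (N i) ^ s) = 0"
  shows "c i = 0"
proof (rule ccontr)
  assume "c i \<noteq> 0"
  define n where "n = (LEAST n. \<exists>i. N i = n \<and> c i \<noteq> 0)"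
  have "\<exists>i. N i = n \<and> c i \<noteq> 0"
    unfolding n_def by (rule LeastI_ex) (use \<open>c i \<noteq> 0\<close> in blast)
  then obtain j where j: "N j = n" "c j \<noteq> 0" by blast
  have larger: "n + 1 \<le> N i" if "c i \<noteq> 0" "i \<noteq> j" for i
  proof -
    have "n \<le> N i" unfolding n_def by (rule Least_le) (use that in blast)
    moreover have "N i \<noteq> n" using that j N(1) by (metis injD)
    ultimately show ?thesis by simp
  qed
  have n: "n \<ge> 1" using N(2)[of j] j by simp
  define B where "B = (\<Sum>\<^sub>\<infinity>i\<in>-{j}. cmod (c i) / real (N i) ^ s0)"
  have summ_j: "(\<lambda>i. cmod (c i) / real (N i) ^ s0) summable_on (-{j})"
    using summ by (rule summable_on_subset_banach) simp
  have le: "cmod (c j) \<le> real n ^ s0 * B * (real n / real (n + 1)) ^ m" for m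
  proof -
    define f where "f = (\<lambda>i. c i / of_nat (N i) ^ (s0 + m))"
    have fle: "cmod (f i) \<le> cmod (c i) / real (N i) ^ s0 * (1 / real (n + 1) ^ m)"
      if "i \<noteq> j" for i
    proof (cases "c i = 0")
      case False
      have "real (n + 1) ^ m \<le> real (N i) ^ m"
        using larger[OF False that] by (intro power_mono) auto
      then have "cmod (c i) / real (N i) ^ s0 * (1 / real (N i) ^ m)
          \<le> cmod (c i) / real (N i) ^ s0 * (1 / real (n + 1) ^ m)"
        using N(2)[of i] by (intro mult_left_mono divide_left_mono) auto
      then show ?thesis by (simp add: f_def norm_divide norm_mult norm_power power_add)
    qed (simp add: f_def)
    have bound: "(\<lambda>i. cmod (c i) / real (N i) ^ s0 * (1 / real (n + 1) ^ m)) summable_on (-{j})"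
      by (rule summable_on_cmult_left[OF summ_j])
    have fnorm: "(\<lambda>i. norm (f i)) summable_on (-{j})"
      by (rule summable_on_comparison_test[OF bound]) (use fle in auto)
    have "f summable_on (-{j})" by (rule abs_summable_summable[OF fnorm])
    then have "(f has_sum (\<Sum>\<^sub>\<infinity>i\<in>-{j}. f i)) (-{j})" by (rule has_sum_infsum)
    then have "(f has_sum (f j + (\<Sum>\<^sub>\<infinity>i\<in>-{j}. f i))) (insert j (-{j}))"
      by (rule has_sum_insert[rotated]) simp
    moreover have "insert j (-{j}) = UNIV" by auto
    ultimately have "(\<Sum>\<^sub>\<infinity>i. f i) = f j + (\<Sum>\<^sub>\<infinity>i\<in>-{j}. f i)" by (simp add: infsumI)
    then have "f j = - (\<Sum>\<^sub>\<infinity>i\<in>-{j}. f i)"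
      using zero[of "s0 + m"] by (simp add: f_def add_eq_0_iff2)
    then have "cmod (f j) = cmod (\<Sum>\<^sub>\<infinity>i\<in>-{j}. f i)" by simp
    also have "\<dots> \<le> (\<Sum>\<^sub>\<infinity>i\<in>-{j}. cmod (f i))" by (rule norm_infsum_bound[OF fnorm])
    also have "\<dots> \<le> (\<Sum>\<^sub>\<infinity>i\<in>-{j}. cmod (c i) / real (N i) ^ s0 * (1 / real (n + 1) ^ m))"
      by (rule infsum_mono[OF fnorm bound]) (use fle in auto)
    also have "\<dots> = B * (1 / real (n + 1) ^ m)"
      unfolding B_def by (rule infsum_cmult_left')
    finally have "cmod (c j) / real n ^ (s0 + m) \<le> B / real (n + 1) ^ m"
      using j by (simp add: f_def norm_divide norm_power)
    then have "cmod (c j) \<le> B / real (n + 1) ^ m * real n ^ (s0 + m)"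
      using n by (simp add: pos_divide_le_eq)
    then show ?thesis by (simp add: power_add power_divide mult_ac)
  qed
  have "(\<lambda>m. (real n / real (n + 1)) ^ m) \<longlonglongrightarrow> 0"
    by (rule LIMSEQ_realpow_zero) auto
  then have "(\<lambda>m. real n ^ s0 * B * (real n / real (n + 1)) ^ m) \<longlonglongrightarrow> real n ^ s0 * B * 0"
    by (rule tendsto_mult_left)
  then have "cmod (c j) \<le> real n ^ s0 * B * 0"
    by (rule LIMSEQ_le_const) (use le in auto)
  then show False using j by simp
qed

lemma mpow_superset:
  assumes "finite A" "Poly_Mapping.keys \<alpha> \<subseteq> A"
  shows "mpow z \<alpha> = (\<Prod>i\<in>A. z i ^ Poly_Mapping.lookup \<alpha> i)"
  unfolding mpow_def using assms
  by (intro prod.mono_neutral_left) (auto simp: in_keys_iff)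

lemma mpow_0 [simp]: "mpow z 0 = 1"
  by (simp add: mpow_def)

lemma mpow_single [simp]: "mpow z (Poly_Mapping.single j 1) = z j"
  by (simp add: mpow_def)

lemma mpow_add: "mpow z (\<alpha> + \<beta>) = mpow z \<alpha> * mpow z \<beta>"
proof -
  define A where "A = Poly_Mapping.keys \<alpha> \<union> Poly_Mapping.keys \<beta>"
  have A: "finite A" "Poly_Mapping.keys \<alpha> \<subseteq> A" "Poly_Mapping.keys \<beta> \<subseteq> A"
    "Poly_Mapping.keys (\<alpha> + \<beta>) \<subseteq> A"
    using Poly_Mapping.keys_add[of \<alpha> \<beta>] by (auto simp: A_def)
  show ?thesis
    by (simp add: mpow_superset[of A] A lookup_add power_add prod.distrib)
qed

lemma mpow_power:
  fixes x :: "nat \<Rightarrow> 'a::comm_semiring_1"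
  shows "mpow (\<lambda>i. x i ^ n) \<alpha> = mpow x \<alpha> ^ n"
  unfolding mpow_def by (simp add: prod_power_distrib power_mult[symmetric] mult.commute)

lemma cmod_mpow: "cmod (mpow z \<alpha>) = mpow (\<lambda>i. cmod (z i)) \<alpha>"
  by (simp add: mpow_def prod_norm[symmetric] norm_power)

lemma cnj_mpow: "cnj (mpow z \<alpha>) = mpow (\<lambda>i. cnj (z i)) \<alpha>"
  by (simp add: mpow_def)

lemma mpow_mono:
  fixes x y :: "nat \<Rightarrow> real"
  assumes "\<And>i. 0 \<le> x i" "\<And>i. x i \<le> y i"
  shows "mpow x \<alpha> \<le> mpow y \<alpha>"
  unfolding mpow_def using assms by (intro prod_mono) (auto intro: power_mono)

lemma wt_pos: "wt k \<alpha> > 0"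
  unfolding wt_def mpow_def by (intro prod_pos) auto

lemma wt_add: "wt k (\<alpha> + \<beta>) = wt k \<alpha> * wt k \<beta>"
  by (simp add: wt_def mpow_add)

lemma wt_single: "wt k (Poly_Mapping.single j 1) = (2 * real (Suc j)) ^ k"
  by (simp only: wt_def mpow_single)

text \<open>
  The primes are spread out so that \<open>big_prime i\<close> dominates the factor \<open>2 (i + 1)\<close> in \<^const>\<open>wt\<close>.
\<close>
definition big_prime :: "nat \<Rightarrow> nat" where
  "big_prime i = enumerate {p. prime p} (2 * i + 2)"

lemma prime_big_prime: "prime (big_prime i)"
  using enumerate_in_set[OF primes_infinite, of "2 * i + 2"] by (simp add: big_prime_def)

lemma big_prime_ge: "2 * Suc i \<le> big_prime i"
  using le_enumerate[OF primes_infinite, of "2 * i + 2"] by (simp add: big_prime_def)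

lemma inj_big_prime: "inj big_prime"
  using strict_mono_enumerate[OF primes_infinite]
  by (auto simp: inj_def big_prime_def strict_mono_eq)

text \<open>
  Unique factorisation identifies multi-indices with certain natural numbers, by which they are ordered.
\<close>
definition godel :: "(nat \<Rightarrow>\<^sub>0 nat) \<Rightarrow> nat" where
  "godel \<alpha> = mpow big_prime \<alpha>"

lemma godel_ge_1: "godel \<alpha> \<ge> 1"
  using prime_gt_0_nat[OF prime_big_prime] by (simp add: godel_def mpow_def Suc_le_eq prod_pos)

lemma inj_godel: "inj godel"
proof
  fix \<alpha> \<beta> assume eq: "godel \<alpha> = godel \<beta>"
  have lookup: "multiplicity (big_prime i) (godel \<alpha>) = Poly_Mapping.lookup \<alpha> i" for \<alpha> i
  proof -
    define A where "A = insert i (Poly_Mapping.keys \<alpha>)"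
    define f where "f = (\<lambda>p. Poly_Mapping.lookup \<alpha> (inv big_prime p))"
    have "godel \<alpha> = (\<Prod>i\<in>A. big_prime i ^ Poly_Mapping.lookup \<alpha> i)"
      unfolding godel_def by (rule mpow_superset) (auto simp: A_def)
    also have "\<dots> = (\<Prod>p\<in>big_prime ` A. p ^ f p)"
      using inj_big_prime by (subst prod.reindex) (auto simp: f_def inj_on_def)
    finally have "multiplicity (big_prime i) (godel \<alpha>) = (if big_prime i \<in> big_prime ` A then f (big_prime i) else 0)"
      by (simp only:) (rule multiplicity_prod_prime_powers, auto simp: A_def prime_big_prime)
    then show ?thesis using inj_big_prime by (simp add: A_def f_def)
  qed
  show "\<alpha> = \<beta>" by (rule poly_mapping_eqI) (metis eq lookup)
qed

lemma wt_le_godel: "wt k \<alpha> \<le> real (godel \<alpha>) ^ k"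
proof -
  have "wt k \<alpha> = mpow (\<lambda>i. 2 * real (Suc i)) \<alpha> ^ k" by (simp add: wt_def mpow_power)
  also have "\<dots> \<le> mpow (\<lambda>i. real (big_prime i)) \<alpha> ^ k"
  proof (intro power_mono mpow_mono)
    show "2 * real (Suc i) \<le> real (big_prime i)" for i
      using of_nat_mono[OF big_prime_ge[of i], where 'a = real] by simp
    show "0 \<le> mpow (\<lambda>i. 2 * real (Suc i)) \<alpha>" by (auto simp: mpow_def intro!: prod_nonneg)
  qed auto
  also have "mpow (\<lambda>i. real (big_prime i)) \<alpha> = real (godel \<alpha>)"
    by (simp add: godel_def mpow_def)
  finally show ?thesis .
qed

text \<open>
  The point whose monomials are the terms of a Dirichlet series.
\<close>
definition dirichlet_point :: "nat \<Rightarrow> nat \<Rightarrow> complex" where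
  "dirichlet_point s = (\<lambda>i. 1 / of_nat (big_prime i) ^ s)"

lemma mpow_dirichlet_point: "mpow (dirichlet_point s) \<alpha> = 1 / of_nat (godel \<alpha>) ^ s"
proof -
  have "mpow (dirichlet_point s) \<alpha> = mpow (\<lambda>i. 1 / of_nat (big_prime i)) \<alpha> ^ s"
    unfolding dirichlet_point_def by (simp add: mpow_power[symmetric] power_one_over)
  also have "mpow (\<lambda>i. 1 / of_nat (big_prime i) :: complex) \<alpha> = 1 / of_nat (godel \<alpha>)"
    by (simp add: godel_def mpow_def prod_dividef power_one_over)
  finally show ?thesis by (simp add: power_one_over)
qed

text \<open>
  The weight is at most \<open>n\<^sup>k\<close> for the Goedel number \<open>n\<close>, so \<open>s \<ge> k + 2\<close> leaves a subseries of \<open>\<Sum> n\<^sup>-\<^sup>2\<close>.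
\<close>
lemma dirichlet_point_in_KK:
  assumes "s \<ge> k + 2"
  shows "dirichlet_point s \<in> KK k"
proof -
  have "summable (\<lambda>n. 1 / real n ^ 2)"
    using inverse_power_summable[of 2, where 'a = real] by (simp add: inverse_eq_divide)
  then have "(\<lambda>n. 1 / real n ^ 2) summable_on UNIV"
    by (subst summable_on_UNIV_nonneg_real_iff) auto
  then have "(\<lambda>n. 1 / real n ^ 2) summable_on range godel"
    by (rule summable_on_subset_banach) simp
  then have "(\<lambda>\<alpha>. 1 / real (godel \<alpha>) ^ 2) summable_on UNIV"
    by (simp add: summable_on_reindex[OF inj_godel] o_def)
  then have "(\<lambda>\<alpha>. (mpow (\<lambda>i. cmod (dirichlet_point s i)) \<alpha>)\<^sup>2 * wt k \<alpha>) summable_on UNIV"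
  proof (rule summable_on_comparison_test)
    fix \<alpha> :: "nat \<Rightarrow>\<^sub>0 nat"
    define n where "n = real (godel \<alpha>)"
    have n: "n \<ge> 1" using godel_ge_1[of \<alpha>] by (simp add: n_def)
    have "(mpow (\<lambda>i. cmod (dirichlet_point s i)) \<alpha>)\<^sup>2 * wt k \<alpha> \<le> (1 / n ^ s)\<^sup>2 * n ^ k"
      unfolding cmod_mpow[symmetric] mpow_dirichlet_point
      using wt_le_godel[of k \<alpha>] by (intro mult_mono) (auto simp: n_def norm_divide norm_power wt_pos less_imp_le)
    also have "\<dots> \<le> 1 / n\<^sup>2"
    proof -
      have "n ^ (k + 2) \<le> n ^ (2 * s)" using n assms by (intro power_increasing) auto
      then show ?thesis using n by (simp add: field_simps power_add power_mult power2_eq_square)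
    qed
    finally show "(mpow (\<lambda>i. cmod (dirichlet_point s i)) \<alpha>)\<^sup>2 * wt k \<alpha> \<le> 1 / (real (godel \<alpha>))\<^sup>2"
      by (simp add: n_def)
    show "0 \<le> (mpow (\<lambda>i. cmod (dirichlet_point s i)) \<alpha>)\<^sup>2 * wt k \<alpha>"
      using wt_pos[of k \<alpha>] by simp
  qed
  then show ?thesis by (simp add: KK_def)
qed

section \<open>The power series space as a sequence space\<close>

definition HK_basis :: "nat \<Rightarrow> (nat \<Rightarrow>\<^sub>0 nat) \<Rightarrow> (nat \<Rightarrow> complex) \<Rightarrow> complex" where
  "HK_basis k \<alpha> z = mpow z \<alpha> * of_real (sqrt (wt k \<alpha>))"

interpretation HK: feature_space "KK k" "HK_basis k" for k
proof
  fix z assume "z \<in> KK k"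
  then show "(\<lambda>\<alpha>. HK_basis k \<alpha> z) \<in> ell2"
    using wt_pos[of k]
    by (simp add: ell2_def KK_def HK_basis_def norm_mult power_mult_distrib cmod_mpow less_imp_le)
qed

lemma HK_ev_eq_0D:
  assumes a: "a \<in> ell2" and zero: "\<And>z. z \<in> KK k \<Longrightarrow> HK.ev k a z = 0"
  shows "a = (\<lambda>_. 0)"
proof
  fix \<alpha>
  define c where "c = (\<lambda>\<alpha>. a \<alpha> * of_real (sqrt (wt k \<alpha>)))"
  have eq: "a \<alpha> * HK_basis k \<alpha> (dirichlet_point s) = c \<alpha> / of_nat (godel \<alpha>) ^ s" for s \<alpha>
    by (simp add: c_def HK_basis_def mpow_dirichlet_point)
  have "c \<alpha> = 0"
  proof (rule Dirichlet_coefficients_unique[OF inj_godel godel_ge_1, of c "k + 2"])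
    have "(\<lambda>\<alpha>. norm (a \<alpha> * HK_basis k \<alpha> (dirichlet_point (k + 2)))) summable_on UNIV"
      by (intro ell2_product_abs_summable a HK.feature_ell2 dirichlet_point_in_KK) simp
    then show "(\<lambda>\<alpha>. cmod (c \<alpha>) / real (godel \<alpha>) ^ (k + 2)) summable_on UNIV"
      unfolding eq by (simp add: norm_divide norm_power norm_mult)
  next
    fix s assume s: "s \<ge> k + 2"
    show "(\<Sum>\<^sub>\<infinity>\<alpha>. c \<alpha> / of_nat (godel \<alpha>) ^ s) = 0"
      using zero[OF dirichlet_point_in_KK[OF s]] dirichlet_point_in_KK[OF s] by (simp add: HK.ev_def eq)
  qed
  then show "a \<alpha> = 0" using wt_pos[of k \<alpha>] by (simp add: c_def)
qed

lemma inj_on_HK_ev: "inj_on (HK.ev k) ell2"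
  by (intro HK.inj_on_evI HK_ev_eq_0D)

text \<open>
  Coefficients with respect to the orthonormal basis \<^const>\<open>HK_basis\<close> instead of the monomials.
\<close>
definition normalize_coeffs :: "nat \<Rightarrow> ((nat \<Rightarrow>\<^sub>0 nat) \<Rightarrow> complex) \<Rightarrow> (nat \<Rightarrow>\<^sub>0 nat) \<Rightarrow> complex" where
  "normalize_coeffs k c = (\<lambda>\<alpha>. c \<alpha> / of_real (sqrt (wt k \<alpha>)))"

lemma cmod_normalize_coeffs: "(cmod (normalize_coeffs k c \<alpha>))\<^sup>2 = (cmod (c \<alpha>))\<^sup>2 / wt k \<alpha>"
  using wt_pos[of k \<alpha>] by (simp add: normalize_coeffs_def norm_divide power_divide)

lemma H_coeffs_iff: "c \<in> H_coeffs k \<longleftrightarrow> normalize_coeffs k c \<in> ell2"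
  by (simp add: H_coeffs_def ell2_def cmod_normalize_coeffs)

lemma H_fun_eq_ev: "H_fun k c = HK.ev k (normalize_coeffs k c)"
proof -
  have eq: "normalize_coeffs k c \<alpha> * HK_basis k \<alpha> z = c \<alpha> * mpow z \<alpha>" for \<alpha> z
    using wt_pos[of k \<alpha>] by (simp add: normalize_coeffs_def HK_basis_def)
  show ?thesis by (auto simp: fun_eq_iff H_fun_def HK.ev_def eq)
qed

lemma bij_normalize_coeffs: "bij_betw (normalize_coeffs k) (H_coeffs k) ell2"
proof (rule bij_betw_byWitness[where f' = "\<lambda>a \<alpha>. a \<alpha> * of_real (sqrt (wt k \<alpha>))"])
  have w: "wt k \<alpha> \<noteq> 0" for \<alpha> using wt_pos[of k \<alpha>] by simp
  have inv: "normalize_coeffs k (\<lambda>\<alpha>. a \<alpha> * of_real (sqrt (wt k \<alpha>))) = a" for a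
    using w by (simp add: normalize_coeffs_def)
  then show "\<forall>a\<in>ell2. normalize_coeffs k (\<lambda>\<alpha>. a \<alpha> * of_real (sqrt (wt k \<alpha>))) = a" by blast
  show "(\<lambda>a \<alpha>. a \<alpha> * of_real (sqrt (wt k \<alpha>))) ` ell2 \<subseteq> H_coeffs k"
    using inv by (auto simp: H_coeffs_iff)
  show "\<forall>c\<in>H_coeffs k. (\<lambda>\<alpha>. normalize_coeffs k c \<alpha> * of_real (sqrt (wt k \<alpha>))) = c"
    using w by (simp add: normalize_coeffs_def)
qed (auto simp: H_coeffs_iff)

lemma HK_eq: "HK k = HK.ev k ` ell2"
  unfolding HK_def bij_betw_imp_surj_on[OF bij_normalize_coeffs[of k], symmetric] image_image
  by (rule image_cong) (simp_all add: H_fun_eq_ev)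

lemma H_norm_ev:
  assumes a: "a \<in> ell2"
  shows "H_norm k (HK.ev k a) = sqrt (norm_sq a)"
proof -
  have "a \<in> normalize_coeffs k ` H_coeffs k"
    using a by (simp only: bij_betw_imp_surj_on[OF bij_normalize_coeffs])
  then obtain c where c: "c \<in> H_coeffs k" "normalize_coeffs k c = a" by auto
  have "inj_on (HK.ev k \<circ> normalize_coeffs k) (H_coeffs k)"
    by (rule comp_inj_on[OF bij_betw_imp_inj_on[OF bij_normalize_coeffs]])
      (simp only: bij_betw_imp_surj_on[OF bij_normalize_coeffs] inj_on_HK_ev)
  then have inj: "inj_on (H_fun k) (H_coeffs k)"
    by (simp add: inj_on_def H_fun_eq_ev)
  have "HK.ev k a = H_fun k c" by (simp add: H_fun_eq_ev c)
  then have "the_inv_into (H_coeffs k) (H_fun k) (HK.ev k a) = c"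
    by (simp add: the_inv_into_f_f[OF inj c(1)])
  then show ?thesis
    by (simp add: H_norm_def norm_sq_def cmod_normalize_coeffs[symmetric] c)
qed

lemma HK_kernel:
  "z \<in> KK k \<Longrightarrow> HK.ev k (HK.kernel_vec k w) z = Kker k z w"
proof -
  assume "z \<in> KK k"
  have "HK.kernel_vec k w \<alpha> * HK_basis k \<alpha> z = mpow z \<alpha> * mpow (\<lambda>i. cnj (w i)) \<alpha> * of_real (wt k \<alpha>)" for \<alpha>
  proof -
    have "complex_of_real (sqrt (wt k \<alpha>)) * complex_of_real (sqrt (wt k \<alpha>)) = of_real (wt k \<alpha>)"
      using wt_pos[of k \<alpha>] by (simp add: of_real_mult[symmetric] del: of_real_mult)
    then show ?thesis by (simp add: HK.kernel_vec_def HK_basis_def cnj_mpow mult_ac)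
  qed
  with \<open>z \<in> KK k\<close> show ?thesis by (simp add: HK.ev_def Kker_def)
qed

section \<open>The tensor product with the Hardy space as a sequence space\<close>

lemma ell2_nat_prod_iff:
  fixes d :: "nat \<times> 'a \<Rightarrow> complex"
  shows "d \<in> ell2 \<longleftrightarrow> (\<forall>n. (\<lambda>\<alpha>. d (n, \<alpha>)) \<in> ell2) \<and> summable (\<lambda>n. norm_sq (\<lambda>\<alpha>. d (n, \<alpha>)))"
  using Infinite_Sum.abs_summable_on_Sigma_iff[of "\<lambda>p. (cmod (d p))\<^sup>2" UNIV "\<lambda>_. UNIV"]
  by (simp add: ell2_def norm_sq_def summable_on_UNIV_nonneg_real_iff infsum_nonneg)

lemma infsum_nat_eq_suminf:
  fixes f :: "nat \<Rightarrow> 'a::banach"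
  assumes "f summable_on UNIV"
  shows "(\<Sum>\<^sub>\<infinity>n. f n) = suminf f"
  using has_sum_imp_sums[OF has_sum_infsum[OF assms]] by (rule sums_unique)

lemma norm_sq_nat_prod:
  fixes d :: "nat \<times> 'a \<Rightarrow> complex"
  assumes "d \<in> ell2"
  shows "norm_sq d = suminf (\<lambda>n. norm_sq (\<lambda>\<alpha>. d (n, \<alpha>)))"
proof -
  have summ: "(\<lambda>p. (cmod (d p))\<^sup>2) summable_on UNIV \<times> UNIV" using assms by (simp add: ell2_def)
  have "(\<lambda>n. norm_sq (\<lambda>\<alpha>. d (n, \<alpha>))) summable_on UNIV"
    using assms by (simp add: ell2_nat_prod_iff summable_on_UNIV_nonneg_real_iff norm_sq_nonneg)
  then show ?thesis
    using infsum_Sigma_banach[OF summ] by (simp add: norm_sq_def infsum_nat_eq_suminf[symmetric])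
qed

definition HHK_basis :: "nat \<Rightarrow> nat \<times> (nat \<Rightarrow>\<^sub>0 nat) \<Rightarrow> complex \<times> (nat \<Rightarrow> complex) \<Rightarrow> complex" where
  "HHK_basis k = (\<lambda>(n, \<alpha>) (\<zeta>, z). \<zeta> ^ n * HK_basis k \<alpha> z)"

interpretation HH: feature_space "ball 0 1 \<times> KK k" "HHK_basis k" for k
proof
  fix x :: "complex \<times> (nat \<Rightarrow> complex)"
  assume "x \<in> ball 0 1 \<times> KK k"
  then obtain \<zeta> z where x: "x = (\<zeta>, z)" "\<zeta> \<in> ball 0 1" "z \<in> KK k" by auto
  have z: "(\<lambda>\<alpha>. HK_basis k \<alpha> z) \<in> ell2" by (rule HK.feature_ell2[OF x(3)])
  have "(cmod (\<zeta> ^ n))\<^sup>2 = ((cmod \<zeta>)\<^sup>2) ^ n" for n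
    by (simp add: norm_power power_mult[symmetric] mult.commute)
  moreover have "summable (\<lambda>n. ((cmod \<zeta>)\<^sup>2) ^ n)"
    using x(2) by (intro summable_geometric) (simp add: abs_square_less_1)
  ultimately have "summable (\<lambda>n. (cmod (\<zeta> ^ n))\<^sup>2 * norm_sq (\<lambda>\<alpha>. HK_basis k \<alpha> z))"
    by (intro summable_mult2) simp
  then show "(\<lambda>i. HHK_basis k i x) \<in> ell2"
    using z by (simp add: ell2_nat_prod_iff x HHK_basis_def ell2_scale norm_sq_scale)
qed

lemma HH_ev_expansion:
  assumes d: "d \<in> ell2" and x: "\<zeta> \<in> ball 0 1" "z \<in> KK k"
  shows "(\<lambda>n. \<zeta> ^ n * HK.ev k (\<lambda>\<alpha>. d (n, \<alpha>)) z) summable_on UNIV"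
    and "HH.ev k d (\<zeta>, z) = (\<Sum>\<^sub>\<infinity>n. \<zeta> ^ n * HK.ev k (\<lambda>\<alpha>. d (n, \<alpha>)) z)"
proof -
  define f where "f = (\<lambda>n \<alpha>. d (n, \<alpha>) * HHK_basis k (n, \<alpha>) (\<zeta>, z))"
  have "(\<lambda>i. d i * HHK_basis k i (\<zeta>, z)) summable_on UNIV"
    by (rule abs_summable_summable[OF ell2_product_abs_summable[OF d HH.feature_ell2[of _ k]]])
      (use x in auto)
  then have f: "(\<lambda>(n, \<alpha>). f n \<alpha>) summable_on UNIV \<times> UNIV"
    by (simp add: f_def case_prod_unfold)
  have row: "(\<Sum>\<^sub>\<infinity>\<alpha>. f n \<alpha>) = \<zeta> ^ n * HK.ev k (\<lambda>\<alpha>. d (n, \<alpha>)) z" for n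
  proof -
    have "(\<Sum>\<^sub>\<infinity>\<alpha>. f n \<alpha>) = (\<Sum>\<^sub>\<infinity>\<alpha>. \<zeta> ^ n * (d (n, \<alpha>) * HK_basis k \<alpha> z))"
      by (simp add: f_def HHK_basis_def mult_ac)
    also have "\<dots> = \<zeta> ^ n * (\<Sum>\<^sub>\<infinity>\<alpha>. d (n, \<alpha>) * HK_basis k \<alpha> z)" by (rule infsum_cmult_right')
    finally show ?thesis using x by (simp add: HK.ev_def)
  qed
  show "(\<lambda>n. \<zeta> ^ n * HK.ev k (\<lambda>\<alpha>. d (n, \<alpha>)) z) summable_on UNIV"
    using summable_on_Sigma_banach[OF f] by (simp add: row)
  show "HH.ev k d (\<zeta>, z) = (\<Sum>\<^sub>\<infinity>n. \<zeta> ^ n * HK.ev k (\<lambda>\<alpha>. d (n, \<alpha>)) z)"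
    using infsum_Sigma'_banach[OF f] x unfolding row
    by (simp add: HH.ev_def f_def case_prod_unfold)
qed

lemma HH_fun_eq_ev:
  assumes d: "d \<in> ell2"
  shows "HH_fun (\<lambda>n. HK.ev k (\<lambda>\<alpha>. d (n, \<alpha>))) = HH.ev k d"
proof
  fix x :: "complex \<times> (nat \<Rightarrow> complex)"
  obtain \<zeta> z where x: "x = (\<zeta>, z)" by (cases x)
  show "HH_fun (\<lambda>n. HK.ev k (\<lambda>\<alpha>. d (n, \<alpha>))) x = HH.ev k d x"
  proof (cases "\<zeta> \<in> ball 0 1 \<and> z \<in> KK k")
    case True
    then show ?thesis
      using HH_ev_expansion[OF d, of \<zeta> z k] by (simp add: x HH_fun_def infsum_nat_eq_suminf)
  next
    case False
    then show ?thesis by (auto simp: x HH_fun_def HH.ev_outside HK.ev_outside)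
  qed
qed

text \<open>
  At \<open>\<zeta> = 2\<^sup>-\<^sup>s\<close> the power series in \<open>\<zeta>\<close> is a Dirichlet series over the powers of 2, so all its coefficients vanish as
  functions of \<open>z\<close>; then the uniqueness result for \<^const>\<open>HK_basis\<close> applies to each of them.
\<close>
lemma HH_ev_eq_0D:
  assumes d: "d \<in> ell2" and zero: "\<And>x. x \<in> ball 0 1 \<times> KK k \<Longrightarrow> HH.ev k d x = 0"
  shows "d = (\<lambda>_. 0)"
proof -
  have row: "(\<lambda>\<alpha>. d (n, \<alpha>)) = (\<lambda>_. 0)" for n
  proof (rule HK_ev_eq_0D)
    show row_ell2: "(\<lambda>\<alpha>. d (n, \<alpha>)) \<in> ell2" for n using d by (simp add: ell2_nat_prod_iff)
    fix z assume z: "z \<in> KK k"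
    define c where "c = (\<lambda>n. HK.ev k (\<lambda>\<alpha>. d (n, \<alpha>)) z)"
    have ball: "(1 / 2 ^ s :: complex) \<in> ball 0 1" if "s \<ge> 1" for s :: nat
      using that by (simp add: norm_divide norm_power one_less_power)
    have pw: "(1 / 2 ^ s) ^ n * c n = c n / of_nat (2 ^ n) ^ s" for s n
      by (simp add: power_divide power_mult[symmetric] mult.commute)
    have "c n = 0"
    proof (rule Dirichlet_coefficients_unique[of "\<lambda>n. 2 ^ n" c 1])
      show "inj (\<lambda>n. 2 ^ n :: nat)" by (auto simp: inj_def)
      have summ: "(\<lambda>n. (1 / 2 ^ 1) ^ n * c n) summable_on UNIV"
        unfolding c_def by (rule HH_ev_expansion(1)[OF d ball z]) simp
      then show "(\<lambda>n. cmod (c n) / real (2 ^ n) ^ 1) summable_on UNIV"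
        unfolding pw
        by (simp add: summable_on_iff_abs_summable_on_complex norm_divide norm_power)
    next
      fix s :: nat assume s: "s \<ge> 1"
      have "(\<Sum>\<^sub>\<infinity>n. (1 / 2 ^ s) ^ n * c n) = HH.ev k d (1 / 2 ^ s, z)"
        unfolding c_def by (rule HH_ev_expansion(2)[OF d ball[OF s] z, symmetric])
      also have "\<dots> = 0" by (rule zero) (use ball[OF s] z in simp)
      finally show "(\<Sum>\<^sub>\<infinity>n. c n / of_nat (2 ^ n) ^ s) = 0" unfolding pw .
    qed simp
    then show "HK.ev k (\<lambda>\<alpha>. d (n, \<alpha>)) z = 0" by (simp add: c_def)
  qed
  show ?thesis
  proof
    fix p show "d p = 0" using fun_cong[OF row[of "fst p"], of "snd p"] by simp
  qed
qed

lemma inj_on_HH_ev: "inj_on (HH.ev k) ell2"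
  by (intro HH.inj_on_evI HH_ev_eq_0D)

lemma HH_coeffs_eq: "HH_coeffs k = (\<lambda>d (n::nat). HK.ev k (\<lambda>\<alpha>. d (n, \<alpha>))) ` ell2"
proof (intro equalityI subsetI)
  fix F assume F: "F \<in> HH_coeffs k"
  then have "\<forall>n. \<exists>a\<in>ell2. F n = HK.ev k a" by (auto simp: HH_coeffs_def HK_eq image_iff)
  then obtain a where a: "\<And>n. a n \<in> ell2" "\<And>n. F n = HK.ev k (a n)" by metis
  define d where "d = (\<lambda>(n, \<alpha>). a n \<alpha>)"
  have "d \<in> ell2"
    using F by (simp add: ell2_nat_prod_iff d_def a HH_coeffs_def H_norm_ev norm_sq_nonneg)
  moreover have "F = (\<lambda>n. HK.ev k (\<lambda>\<alpha>. d (n, \<alpha>)))" using a by (auto simp: d_def)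
  ultimately show "F \<in> (\<lambda>d (n::nat). HK.ev k (\<lambda>\<alpha>. d (n, \<alpha>))) ` ell2" by blast
next
  fix F assume "F \<in> (\<lambda>d (n::nat). HK.ev k (\<lambda>\<alpha>. d (n, \<alpha>))) ` ell2"
  then obtain d where d: "d \<in> ell2" "F = (\<lambda>n. HK.ev k (\<lambda>\<alpha>. d (n, \<alpha>)))" by auto
  then show "F \<in> HH_coeffs k"
    by (auto simp: HH_coeffs_def HK_eq H_norm_ev ell2_nat_prod_iff norm_sq_nonneg)
qed

lemma HHK_eq: "HHK k = HH.ev k ` ell2"
  unfolding HHK_def HH_coeffs_eq image_image
  by (rule image_cong) (simp_all add: HH_fun_eq_ev)

lemma HH_norm_ev:
  assumes d: "d \<in> ell2"
  shows "HH_norm k (HH.ev k d) = sqrt (norm_sq d)"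
proof -
  have inj: "inj_on HH_fun (HH_coeffs k)"
    unfolding HH_coeffs_eq using inj_on_HH_ev[of k]
    by (auto simp: inj_on_def HH_fun_eq_ev)
  have "(\<lambda>n. HK.ev k (\<lambda>\<alpha>. d (n, \<alpha>))) \<in> HH_coeffs k" using d by (auto simp: HH_coeffs_eq)
  then have "the_inv_into (HH_coeffs k) HH_fun (HH.ev k d) = (\<lambda>n. HK.ev k (\<lambda>\<alpha>. d (n, \<alpha>)))"
    unfolding HH_fun_eq_ev[OF d, symmetric] by (rule the_inv_into_f_f[OF inj])
  moreover have "(\<lambda>\<alpha>. d (n, \<alpha>)) \<in> ell2" for n using d by (simp add: ell2_nat_prod_iff)
  ultimately show ?thesis
    by (simp add: HH_norm_def H_norm_ev norm_sq_nonneg norm_sq_nat_prod[OF d])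
qed

text \<open>
  Row \<open>n\<close> of the kernel vector at \<open>(\<nu>, w)\<close> is \<open>(\<nu>\<^sup>*)\<^sup>n\<close> times the kernel vector at \<open>w\<close>, so a geometric series is left.
\<close>
lemma HH_kernel:
  assumes "\<zeta> \<in> ball 0 1" "z \<in> KK k" "\<nu> \<in> ball 0 1" "w \<in> KK k"
  shows "HH.kernel k (\<zeta>, z) (\<nu>, w) = Kker k z w / (1 - \<zeta> * cnj \<nu>)"
proof -
  have q: "cmod (\<zeta> * cnj \<nu>) < 1"
    using assms mult_strict_mono'[of "cmod \<zeta>" 1 "cmod \<nu>" 1] by (simp add: norm_mult)
  have row: "HK.ev k (\<lambda>\<alpha>. HH.kernel_vec k (\<nu>, w) (n, \<alpha>)) z = cnj \<nu> ^ n * Kker k z w" for n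
  proof -
    have "HH.kernel_vec k (\<nu>, w) (n, \<alpha>) = cnj \<nu> ^ n * HK.kernel_vec k w \<alpha>" for \<alpha>
      unfolding HH.kernel_vec_def HK.kernel_vec_def by (simp add: HHK_basis_def)
    then have "HK.ev k (\<lambda>\<alpha>. HH.kernel_vec k (\<nu>, w) (n, \<alpha>)) z
        = (\<Sum>\<^sub>\<infinity>\<alpha>. cnj \<nu> ^ n * (HK.kernel_vec k w \<alpha> * HK_basis k \<alpha> z))"
      using assms by (simp add: HK.ev_def mult_ac)
    also have "\<dots> = cnj \<nu> ^ n * (\<Sum>\<^sub>\<infinity>\<alpha>. HK.kernel_vec k w \<alpha> * HK_basis k \<alpha> z)" by (rule infsum_cmult_right')
    also have "(\<Sum>\<^sub>\<infinity>\<alpha>. HK.kernel_vec k w \<alpha> * HK_basis k \<alpha> z) = Kker k z w"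
      using HK_kernel[OF assms(2), of w] assms by (simp add: HK.ev_def)
    finally show ?thesis .
  qed
  have "HH.kernel k (\<zeta>, z) (\<nu>, w) = HH.ev k (HH.kernel_vec k (\<nu>, w)) (\<zeta>, z)"
    unfolding HH.kernel_def by (rule HH.ev_eq_ell2_inner[symmetric]) (use assms in auto)
  also have "\<dots> = (\<Sum>\<^sub>\<infinity>n. \<zeta> ^ n * (cnj \<nu> ^ n * Kker k z w))"
    unfolding row[symmetric] using assms by (intro HH_ev_expansion(2) HH.kernel_vec_ell2) auto
  also have "\<dots> = (\<Sum>\<^sub>\<infinity>n. (\<zeta> * cnj \<nu>) ^ n * Kker k z w)"
    by (simp add: power_mult_distrib mult_ac)
  also have "\<dots> = (\<Sum>\<^sub>\<infinity>n. (\<zeta> * cnj \<nu>) ^ n) * Kker k z w" by (rule infsum_cmult_left')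
  also have "(\<Sum>\<^sub>\<infinity>n. (\<zeta> * cnj \<nu>) ^ n) = 1 / (1 - \<zeta> * cnj \<nu>)"
  proof -
    have "summable (\<lambda>n. norm ((\<zeta> * cnj \<nu>) ^ n))"
      unfolding norm_power using q by (intro summable_geometric) simp
    then have "(\<lambda>n. (\<zeta> * cnj \<nu>) ^ n) summable_on UNIV" by (rule norm_summable_imp_summable_on)
    then show ?thesis using q by (simp add: infsum_nat_eq_suminf suminf_geometric)
  qed
  finally show ?thesis by simp
qed

section \<open>Multiplication by the coordinates\<close>

lemma mindex_induct [case_names zero add]:
  assumes "P 0" and "\<And>\<alpha> j. P \<alpha> \<Longrightarrow> P (\<alpha> + Poly_Mapping.single j (1::nat))"
  shows "P \<alpha>"
proof (induction \<alpha> rule: update_induct)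
  case (update f a b)
  have "P (f + Poly_Mapping.single a b)" for b
  proof (induction b)
    case (Suc b)
    have "f + Poly_Mapping.single a (Suc b) = f + Poly_Mapping.single a b + Poly_Mapping.single a 1"
      by (simp add: add.assoc single_add[symmetric])
    then show ?case using assms(2)[OF Suc] by simp
  qed (use update in simp)
  moreover have "Poly_Mapping.update a b f = f + Poly_Mapping.single a b"
    using update(1)
    by (intro poly_mapping_eqI) (auto simp: lookup_update lookup_add lookup_single when_def in_keys_iff)
  ultimately show ?case by simp
qed (rule assms)

definition coord_shift :: "nat \<Rightarrow> (nat \<Rightarrow>\<^sub>0 nat) \<Rightarrow> (nat \<Rightarrow>\<^sub>0 nat)" where
  "coord_shift j \<alpha> = \<alpha> + Poly_Mapping.single j 1"

text \<open>
  The quotient of the square roots of the weights of \<open>\<alpha>\<close> and of \<open>coord_shift j \<alpha>\<close>, which does not depend on \<open>\<alpha>\<close>.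
\<close>
definition coord_ratio :: "nat \<Rightarrow> nat \<Rightarrow> complex" where
  "coord_ratio k j = 1 / of_real (sqrt ((2 * real (Suc j)) ^ k))"

lemma coord_ratio_neq_0: "coord_ratio k j \<noteq> 0"
  by (simp add: coord_ratio_def)

lemma cmod_coord_ratio_le_1: "cmod (coord_ratio k j) \<le> 1"
proof -
  have "1 \<le> sqrt ((2 * real (Suc j)) ^ k)" by (simp add: one_le_power)
  then show ?thesis unfolding coord_ratio_def norm_divide norm_one norm_of_real by simp
qed

lemma HK_basis_coord_shift: "z j * HK_basis k \<alpha> z = coord_ratio k j * HK_basis k (coord_shift j \<alpha>) z"
proof -
  define q where "q = complex_of_real (sqrt ((2 * real (Suc j)) ^ k))"
  have "q \<noteq> 0" by (simp add: q_def)
  have ratio: "coord_ratio k j = 1 / q" by (simp only: coord_ratio_def q_def)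
  have shift: "HK_basis k (coord_shift j \<alpha>) z = HK_basis k \<alpha> z * (z j * q)"
    by (simp only: HK_basis_def coord_shift_def mpow_add mpow_single wt_add wt_single real_sqrt_mult
        of_real_mult q_def mult_ac)
  show ?thesis unfolding ratio shift using \<open>q \<noteq> 0\<close> by simp
qed

lemma mult_coordinate_HK:
  assumes "a \<in> ell2"
  obtains b where "b \<in> ell2" "HK.ev k b = mult_op (\<lambda>z. z j) (HK.ev k a)" "norm_sq b \<le> norm_sq a"
proof (rule HK.weighted_shift[of "coord_shift j" "\<lambda>_. coord_ratio k j" k "\<lambda>z. z j" a])
  show "inj (coord_shift j)" by (auto simp: inj_def coord_shift_def)
qed (use assms that in \<open>auto simp: cmod_coord_ratio_le_1 HK_basis_coord_shift mult_op_def\<close>)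

lemma mult_zeta_HH:
  assumes "a \<in> ell2"
  obtains b where "b \<in> ell2" "HH.ev k b = mult_op (\<lambda>(\<zeta>, z). \<zeta>) (HH.ev k a)" "norm_sq b \<le> norm_sq a"
proof (rule HH.weighted_shift[of "apfst Suc" "\<lambda>_. 1" k "\<lambda>(\<zeta>, z). \<zeta>" a])
  show "inj (apfst Suc)" by (auto simp: inj_def)
qed (use assms that in \<open>auto simp: HHK_basis_def mult_op_def\<close>)

lemma mult_coordinate_HH:
  assumes "a \<in> ell2"
  obtains b where "b \<in> ell2" "HH.ev k b = mult_op (\<lambda>(\<zeta>, z). z j) (HH.ev k a)" "norm_sq b \<le> norm_sq a"
proof (rule HH.weighted_shift[of "apsnd (coord_shift j)" "\<lambda>_. coord_ratio k j" k "\<lambda>(\<zeta>, z). z j" a])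
  show "inj (apsnd (coord_shift j))" by (auto simp: inj_def coord_shift_def)
  show "(case x of (\<zeta>, z) \<Rightarrow> z j) * HHK_basis k i x = coord_ratio k j * HHK_basis k (apsnd (coord_shift j) i) x" for i x
    using HK_basis_coord_shift[of "snd x" j k "snd i"]
    by (simp add: HHK_basis_def case_prod_unfold mult.left_commute)
qed (use assms that in \<open>auto simp: cmod_coord_ratio_le_1 mult_op_def\<close>)

lemma bounded_mult_coordinate_HK:
  "bounded_operator_on (HK k) (H_norm k) (mult_op (\<lambda>z. z j))"
proof -
  have "linear_operator_on (HK k) (mult_op (\<lambda>z. z j))"
    unfolding HK_eq
  proof (rule HK.linear_operator_onI)
    fix a :: "(nat \<Rightarrow>\<^sub>0 nat) \<Rightarrow> complex" assume "a \<in> ell2"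
    then obtain b where b: "b \<in> ell2" "HK.ev k b = mult_op (\<lambda>z. z j) (HK.ev k a)"
      by (rule mult_coordinate_HK)
    show "\<exists>b\<in>ell2. mult_op (\<lambda>z. z j) (HK.ev k a) = HK.ev k b"
      using b by (intro bexI[of _ b]) (simp_all only:)
  qed simp
  moreover have "H_norm k (mult_op (\<lambda>z. z j) f) \<le> 1 * H_norm k f" if f: "f \<in> HK k" for f
  proof -
    obtain a where a: "a \<in> ell2" "f = HK.ev k a" using f by (auto simp: HK_eq)
    obtain b where b: "b \<in> ell2" "HK.ev k b = mult_op (\<lambda>z. z j) (HK.ev k a)" "norm_sq b \<le> norm_sq a"
      using a(1) by (rule mult_coordinate_HK)
    then show ?thesis unfolding a(2) b(2)[symmetric] by (simp add: H_norm_ev a(1) b(1))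
  qed
  ultimately show ?thesis unfolding bounded_operator_on_def by blast
qed

section \<open>Commuting contractions are multiplications\<close>

lemma positive_kernel_cong:
  assumes "\<And>x y. x \<in> X \<Longrightarrow> y \<in> X \<Longrightarrow> K x y = K' x y"
  shows "positive_kernel X K \<longleftrightarrow> positive_kernel X K'"
proof -
  have "(\<Sum>i<n. \<Sum>j<n. cnj (c i) * K (x i) (x j) * c j) = (\<Sum>i<n. \<Sum>j<n. cnj (c i) * K' (x i) (x j) * c j)"
    if "\<forall>i<n. x i \<in> X" for n :: nat and x c
    using that by (intro sum.cong refl) (simp add: assms)
  then show ?thesis unfolding positive_kernel_def by (simp cong: imp_cong)
qed

lemma positive_kernel_HH_iff:
  "positive_kernel (ball 0 1 \<times> KK k)
     (\<lambda>(\<zeta>, z) (\<nu>, w). (1 - S (\<zeta>, z) * cnj (S (\<nu>, w))) * (Kker k z w / (1 - \<zeta> * cnj \<nu>)))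
   \<longleftrightarrow> positive_kernel (ball 0 1 \<times> KK k) (\<lambda>x y. (1 - S x * cnj (S y)) * HH.kernel k x y)"
  by (rule positive_kernel_cong) (auto simp: HH_kernel)

text \<open>
  Every monomial arises from the constant function 1 by coordinate multiplications, and \<open>T\<close> passes through them.
\<close>
lemma commuting_on_units:
  assumes lin: "linear_operator_on (HHK k) T"
    and zeta: "\<forall>f\<in>HHK k. T (mult_op (\<lambda>(\<zeta>, z). \<zeta>) f) = mult_op (\<lambda>(\<zeta>, z). \<zeta>) (T f)"
    and coord: "\<forall>j. \<forall>f\<in>HHK k. T (mult_op (\<lambda>(\<zeta>, z). z j) f) = mult_op (\<lambda>(\<zeta>, z). z j) (T f)"
  defines "S \<equiv> T (HH.ev k (HH.unit (0, 0)))"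
  shows "T (HH.ev k (HH.unit (n, \<alpha>))) = mult_op S (HH.ev k (HH.unit (n, \<alpha>)))"
proof -
  define M where "M = (\<lambda>n \<alpha>. HH.ev k (HH.unit (n, \<alpha>)))"
  have M_in: "M n \<alpha> \<in> HHK k" for n \<alpha> by (simp add: M_def HHK_eq HH.unit_ell2)
  have M: "M n \<alpha> = (\<lambda>x. if x \<in> ball 0 1 \<times> KK k then HHK_basis k (n, \<alpha>) x else 0)" for n \<alpha>
    unfolding M_def by (rule HH.ev_unit)
  have M_Suc: "M (Suc n) \<alpha> = mult_op (\<lambda>(\<zeta>, z). \<zeta>) (M n \<alpha>)" for n \<alpha>
    by (auto simp: M HHK_basis_def mult_op_def fun_eq_iff)
  have M_coord_shift: "mult_op (\<lambda>(\<zeta>, z). z j) (M n \<alpha>) = (\<lambda>x. coord_ratio k j * M n (\<alpha> + Poly_Mapping.single j 1) x)"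
    for n \<alpha> j
  proof
    fix x :: "complex \<times> (nat \<Rightarrow> complex)"
    obtain \<zeta> z where x: "x = (\<zeta>, z)" by (cases x)
    show "mult_op (\<lambda>(\<zeta>, z). z j) (M n \<alpha>) x = coord_ratio k j * M n (\<alpha> + Poly_Mapping.single j 1) x"
      using HK_basis_coord_shift[of z j k \<alpha>]
      by (simp add: M x HHK_basis_def mult_op_def coord_shift_def mult.left_commute)
  qed
  have T_in: "T (M n \<alpha>) \<in> HHK k" for n \<alpha>
    using lin M_in by (simp add: linear_operator_on_def)
  have "T (M 0 \<alpha>) = mult_op S (M 0 \<alpha>)" for \<alpha>
  proof (induction \<alpha> rule: mindex_induct)
    case zero
    obtain d where d: "T (M 0 0) = HH.ev k d" using T_in[of 0 0] by (auto simp: HHK_eq)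
    have "wt k 0 = 1" by (simp add: wt_def)
    then have one: "M 0 0 x = 1" if "x \<in> ball 0 1 \<times> KK k" for x
      using that by (auto simp: M HHK_basis_def HK_basis_def)
    have S: "S = T (M 0 0)" by (simp only: S_def M_def)
    show ?case
    proof
      fix x
      show "T (M 0 0) x = mult_op S (M 0 0) x"
      proof (cases "x \<in> ball 0 1 \<times> KK k")
        case True
        show ?thesis by (simp only: mult_op_def S one[OF True] mult_1_right)
      next
        case False
        show ?thesis by (simp only: mult_op_def S d HH.ev_outside[OF False] mult_zero_left)
      qed
    qed
  next
    case (add \<alpha> j)
    let ?\<beta> = "\<alpha> + Poly_Mapping.single j 1"
    \<comment> \<open>A shifted basis element is only a nonzero multiple of the product with \<open>z\<^sub>j\<close>; linearity of \<open>T\<close> removes the factor.\<close>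
    have "(\<lambda>x. coord_ratio k j * T (M 0 ?\<beta>) x) = T (\<lambda>x. coord_ratio k j * M 0 ?\<beta> x)"
      using lin M_in by (simp add: linear_operator_on_def)
    also have "\<dots> = mult_op (\<lambda>(\<zeta>, z). z j) (mult_op S (M 0 \<alpha>))"
      unfolding M_coord_shift[symmetric] using coord M_in add by simp
    also have "\<dots> = mult_op S (mult_op (\<lambda>(\<zeta>, z). z j) (M 0 \<alpha>))"
      by (simp add: mult_op_def mult_ac)
    also have "\<dots> = (\<lambda>x. coord_ratio k j * mult_op S (M 0 ?\<beta>) x)"
      unfolding M_coord_shift by (rule mult_op_scale)
    finally show ?case using coord_ratio_neq_0[of k j] by (auto simp: fun_eq_iff)
  qed
  then have "T (M n \<alpha>) = mult_op S (M n \<alpha>)"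
  proof (induction n)
    case (Suc n)
    have "T (M (Suc n) \<alpha>) = mult_op (\<lambda>(\<zeta>, z). \<zeta>) (mult_op S (M n \<alpha>))"
      unfolding M_Suc using zeta M_in Suc by simp
    then show ?case by (simp add: M_Suc mult_op_def mult_ac)
  qed
  then show ?thesis by (simp only: M_def)
qed

theorem theorem5p1:
  fixes k :: nat
  assumes "k \<ge> 1"
  shows "(\<forall>j::nat. bounded_operator_on (HK k) (H_norm k) (mult_op (\<lambda>z. z j))) \<and>
    (\<forall>T :: (complex \<times> (nat \<Rightarrow> complex) \<Rightarrow> complex) \<Rightarrow> complex \<times> (nat \<Rightarrow> complex) \<Rightarrow> complex.
       (linear_operator_on (HHK k) T \<and> contractive_on (HHK k) (HH_norm k) T \<and>
        (\<forall>f\<in>HHK k. T (mult_op (\<lambda>(\<zeta>, z). \<zeta>) f) = mult_op (\<lambda>(\<zeta>, z). \<zeta>) (T f)) \<and>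
        (\<forall>j. \<forall>f\<in>HHK k. T (mult_op (\<lambda>(\<zeta>, z). z j) f) = mult_op (\<lambda>(\<zeta>, z). z j) (T f)))
       \<longleftrightarrow>
       (\<exists>S :: complex \<times> (nat \<Rightarrow> complex) \<Rightarrow> complex.
          (\<forall>f\<in>HHK k. T f = mult_op S f) \<and>
          positive_kernel (ball 0 1 \<times> KK k)
            (\<lambda>(\<zeta>, z) (\<nu>, w).
               (1 - S (\<zeta>, z) * cnj (S (\<nu>, w))) * (Kker k z w / (1 - \<zeta> * cnj \<nu>)))))"
proof (intro conjI allI)
  show "bounded_operator_on (HK k) (H_norm k) (mult_op (\<lambda>z. z j))" for j
    by (rule bounded_mult_coordinate_HK)
next
  fix T :: "(complex \<times> (nat \<Rightarrow> complex) \<Rightarrow> complex) \<Rightarrow> complex \<times> (nat \<Rightarrow> complex) \<Rightarrow> complex"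
  show "(linear_operator_on (HHK k) T \<and> contractive_on (HHK k) (HH_norm k) T \<and>
        (\<forall>f\<in>HHK k. T (mult_op (\<lambda>(\<zeta>, z). \<zeta>) f) = mult_op (\<lambda>(\<zeta>, z). \<zeta>) (T f)) \<and>
        (\<forall>j. \<forall>f\<in>HHK k. T (mult_op (\<lambda>(\<zeta>, z). z j) f) = mult_op (\<lambda>(\<zeta>, z). z j) (T f)))
       \<longleftrightarrow>
       (\<exists>S :: complex \<times> (nat \<Rightarrow> complex) \<Rightarrow> complex.
          (\<forall>f\<in>HHK k. T f = mult_op S f) \<and>
          positive_kernel (ball 0 1 \<times> KK k)
            (\<lambda>(\<zeta>, z) (\<nu>, w).
               (1 - S (\<zeta>, z) * cnj (S (\<nu>, w))) * (Kker k z w / (1 - \<zeta> * cnj \<nu>))))"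
    (is "?commuting \<longleftrightarrow> (\<exists>S. ?multiplier S \<and> ?positive S)")
  proof
    assume T: ?commuting
    define S where "S = T (HH.ev k (HH.unit (0, 0)))"
    have lin: "linear_operator_on (HH.ev k ` ell2) T" using T by (simp add: HHK_eq)
    have contr: "norm_sq b \<le> norm_sq a" if "a \<in> ell2" "b \<in> ell2" "T (HH.ev k a) = HH.ev k b" for a b
    proof -
      have "HH_norm k (T (HH.ev k a)) \<le> HH_norm k (HH.ev k a)"
        using T that(1) by (simp add: contractive_on_def HHK_eq)
      then show ?thesis using that by (simp add: HH_norm_ev)
    qed
    have units: "T (HH.ev k (HH.unit i)) = (\<lambda>x. S x * HH.ev k (HH.unit i) x)" for i
      using commuting_on_units[of k T "fst i" "snd i"] T
      by (simp add: S_def mult_op_def)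
    have mult: "T (HH.ev k a) = (\<lambda>x. S x * HH.ev k a x)" if "a \<in> ell2" for a
      using lin contr units that by (rule HH.contraction_is_multiplier)
    have "positive_kernel (ball 0 1 \<times> KK k) (\<lambda>x y. (1 - S x * cnj (S y)) * HH.kernel k x y)"
    proof (rule HH.positive_kernel_if_contractive_multiplier)
      fix a :: "nat \<times> (nat \<Rightarrow>\<^sub>0 nat) \<Rightarrow> complex" assume a: "a \<in> ell2"
      then obtain b where b: "b \<in> ell2" "T (HH.ev k a) = HH.ev k b"
        using lin by (auto simp: linear_operator_on_def image_iff)
      then show "\<exists>b\<in>ell2. (\<forall>x\<in>ball 0 1 \<times> KK k. HH.ev k b x = S x * HH.ev k a x) \<and> norm_sq b \<le> norm_sq a"
        using contr[OF a b] mult[OF a] by (auto simp: fun_eq_iff)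
    qed
    then have "?positive S" by (simp only: positive_kernel_HH_iff)
    moreover have "?multiplier S" using mult by (auto simp: HHK_eq mult_op_def)
    ultimately show "\<exists>S. ?multiplier S \<and> ?positive S" by blast
  next
    assume "\<exists>S. ?multiplier S \<and> ?positive S"
    then obtain S where S: "?multiplier S" and pos: "?positive S" by blast
    have mult: "T (HH.ev k a) = mult_op S (HH.ev k a)" if "a \<in> ell2" for a
      using S that by (simp add: HHK_eq)
    have contr: "\<exists>b\<in>ell2. mult_op S (HH.ev k a) = HH.ev k b \<and> norm_sq b \<le> norm_sq a" if a: "a \<in> ell2" for a
    proof -
      obtain b where b: "b \<in> ell2" "HH.ev k b = (\<lambda>x. S x * HH.ev k a x)" "norm_sq b \<le> norm_sq a"
        using pos[unfolded positive_kernel_HH_iff] a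
        by (rule HH.contractive_multiplier_if_positive_kernel)
      show ?thesis unfolding mult_op_def using b by (intro bexI[of _ b] conjI) simp_all
    qed
    have "linear_operator_on (HHK k) T"
      unfolding HHK_eq using mult contr by (intro HH.linear_operator_onI) blast+
    moreover have "contractive_on (HHK k) (HH_norm k) T"
      unfolding contractive_on_def
    proof
      fix f assume "f \<in> HHK k"
      then obtain a where a: "a \<in> ell2" "f = HH.ev k a" by (auto simp: HHK_eq)
      obtain b where b: "b \<in> ell2" "mult_op S (HH.ev k a) = HH.ev k b" "norm_sq b \<le> norm_sq a"
        using contr[OF a(1)] by blast
      show "HH_norm k (T f) \<le> HH_norm k f"
        by (simp add: a mult b HH_norm_ev)
    qed
    moreover have "T (mult_op \<phi> f) = mult_op \<phi> (T f)" if "f \<in> HHK k" "mult_op \<phi> f \<in> HHK k" for \<phi> f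
      using S that by (simp add: mult_op_def mult_ac)
    moreover have "mult_op (\<lambda>(\<zeta>, z). \<zeta>) f \<in> HHK k" if f: "f \<in> HHK k" for f
    proof -
      obtain a where a: "a \<in> ell2" "f = HH.ev k a" using f by (auto simp: HHK_eq)
      obtain b where "b \<in> ell2" "HH.ev k b = mult_op (\<lambda>(\<zeta>, z). \<zeta>) (HH.ev k a)"
        using a(1) by (rule mult_zeta_HH)
      then show ?thesis by (metis HHK_eq a(2) imageI)
    qed
    moreover have "mult_op (\<lambda>(\<zeta>, z). z j) f \<in> HHK k" if f: "f \<in> HHK k" for f j
    proof -
      obtain a where a: "a \<in> ell2" "f = HH.ev k a" using f by (auto simp: HHK_eq)
      obtain b where "b \<in> ell2" "HH.ev k b = mult_op (\<lambda>(\<zeta>, z). z j) (HH.ev k a)"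
        using a(1) by (rule mult_coordinate_HH)
      then show ?thesis by (metis HHK_eq a(2) imageI)
    qed
    ultimately show ?commuting by simp
  qed
qed

end
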